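(* Consider a loss network system with advanced reservation with capacity $C$ and traffic intensity $\rho=\sum_{k=1}^M\lambda_k\mu_k$, where the joint reservation/service distributions $(D_k,S_k)$, $k=1,\dots,M$, are discrete, and let $Q_{dsk}$ denote the stationary blocking probability of class-$k$ customers with reservation time $d$ and service time $s$. Let the capacity and the arrival rates tend to infinity, the distributions of $(D_k,S_k)$ and the proportions $\lambda_k/\sum_j\lambda_j$ being kept fixed. (a) In the regime $C=\rho\to\infty$, the blocking probabilities have an asymptotic upper bound of $1/2$: for every class $k$ and all $(d,s)$ with $\mathbb{P}(D_k=d,S_k=s)>0$, $\limsup Q_{dsk}\le 1/2$. (b) In the regime $C=(1+\epsilon)\rho\to\infty$, for any fixed (small) $\epsilon>0$, the blocking probabilities are asymptotically zero: for every class $k$ and all $(d,s)$ with $\mathbb{P}(D_k=d,S_k=s)>0$, $\lim Q_{dsk}=0$.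
   Context: Loss network system with advanced reservation: there is a pool of $C$ identical resource units, $C<\infty$ an integer. Customers of classes $k=1,\dots,M$ arrive according to independent Poisson processes with rates $\lambda_k>0$. A class-$k$ customer arriving at time $t$ requests one resource unit for the service interval $[t+d,t+d+s]$, where $(d,s)$ is drawn from the joint law of $(D_k,S_k)$, independently of the arrival processes and of the other customers ($D_k$ and $S_k$ may be correlated with each other). $D_k$ (reservation time) takes integer values in $\{0,1,\dots,u_k\}$ and $S_k$ (service time) takes integer values in $\{1,\dots,v_k\}$; $\mu_k=\mathbb{E}[S_k]$. A customer is admitted (its interval is reserved, irrevocably) if and only if the maximum, over the requested interval $[t+d,t+d+s]$, of the number of units already reserved before time $t$ is strictly smaller than $C$; otherwise the customer is lost. The underlying booking-profile process is ergodic, and $Q_{dsk}$ is the stationary probability that a class-$k$ customer with reservation time $d$ and service time $s$ arriving at a random time is rejected. *)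

theory Defs
  imports "HOL-Probability.Probability"
begin

text \<open>A Poisson process on the positive half-line, given by its successive points
  \<open>T 0 < T 1 < \<dots>\<close>. The divergence of the points guarantees that the counted sets
  are finite (\<open>card\<close> of an infinite set is \<open>0\<close>).\<close>

definition (in prob_space) poisson_process :: "real \<Rightarrow> (nat \<Rightarrow> 'a \<Rightarrow> real) \<Rightarrow> bool" where
  "poisson_process r T \<longleftrightarrow>
     (\<forall>i. random_variable borel (T i)) \<and>
     (AE \<omega> in M. 0 < T 0 \<omega> \<and> strict_mono (\<lambda>i. T i \<omega>) \<and>
                 filterlim (\<lambda>i. T i \<omega>) at_top sequentially) \<and>
     (\<forall>a b. 0 \<le> a \<and> a < b \<longrightarrow>
        distr M (count_space UNIV) (\<lambda>\<omega>. card {i. a < T i \<omega> \<and> T i \<omega> \<le> b})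
          = measure_pmf (poisson_pmf (r * (b - a)))) \<and>
     (\<forall>t :: nat \<Rightarrow> real. 0 \<le> t 0 \<and> mono t \<longrightarrow>
        indep_vars (\<lambda>_. count_space UNIV)
          (\<lambda>j \<omega>. card {i. t j < T i \<omega> \<and> T i \<omega> \<le> t (Suc j)}) UNIV)"

text \<open>A booking profile \<open>f\<close> gives, for every \<open>x \<ge> 0\<close>, the number \<open>f x\<close> of units that are
  already reserved for the time point lying \<open>x\<close> time units ahead of the present. Its values
  at negative arguments carry no meaning and are never inspected.

  A request \<open>(d, s)\<close> asks for one unit during \<open>[d, d + s]\<close> relative to the present. It is
  admitted iff the maximum of the profile over this interval is smaller than the capacity.\<close>

definition admits :: "nat \<Rightarrow> (real \<Rightarrow> nat) \<Rightarrow> nat \<Rightarrow> nat \<Rightarrow> bool" where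
  "admits C f d s \<longleftrightarrow> (\<forall>x \<in> {real d .. real d + real s}. f x < C)"

text \<open>The profiles that can occur: superpositions of finitely many reservations, each of which
  was made \<open>\<tau> > 0\<close> time units ago by a customer of one of the \<open>K\<close> classes. In particular a
  profile vanishes beyond the largest possible value of \<open>d + s\<close>; without this restriction the
  profile that is constantly \<open>C\<close> would be a spurious invariant state.\<close>

definition booking_profiles ::
    "nat \<Rightarrow> (nat \<Rightarrow> (nat \<times> nat) pmf) \<Rightarrow> nat \<Rightarrow> (real \<Rightarrow> nat) set" where
  "booking_profiles K p C = {f. (\<forall>x\<ge>0. f x \<le> C) \<and>
     (\<exists>bs :: (real \<times> nat \<times> nat) list.
        (\<forall>(\<tau>, d, s) \<in> set bs. 0 < \<tau> \<and> (\<exists>k\<in>{1..K}. (d, s) \<in> set_pmf (p k))) \<and>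
        (\<forall>x\<ge>0. f x = length (filter (\<lambda>(\<tau>, d, s).
                         real d - \<tau> \<le> x \<and> x \<le> real d + real s - \<tau>) bs)))}"

text \<open>The \<open>\<sigma>\<close>-algebra on profiles is generated by the maxima over compact intervals (hence also
  by the evaluations, \<open>a = b\<close>), so that the events \<open>admits C f d s\<close> belong to it.\<close>

definition profile_algebra :: "(real \<Rightarrow> nat) measure" where
  "profile_algebra = sigma UNIV {{f. \<exists>x\<in>{a..b}. c \<le> f x} | a b c. 0 \<le> a}"

lemma blocking_event_measurable: "{f. \<not> admits C f d s} \<in> sets profile_algebra"
proof -
  have "{f. \<not> admits C f d s} = {f. \<exists>x\<in>{real d..real d + real s}. C \<le> f x}"
    by (auto simp: admits_def not_less)
  also have "\<dots> \<in> {{f. \<exists>x\<in>{a..b}. c \<le> f x} | a b c. 0 \<le> a}"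
    by (rule CollectI, rule exI[of _ "real d"], rule exI[of _ "real d + real s"], rule exI[of _ C]) simp
  finally show ?thesis
    unfolding profile_algebra_def by (simp add: sigma_sets.Basic)
qed

datatype source = Initial | Arrivals nat | Request nat nat

text \<open>The loss network with \<open>K\<close> customer classes and capacity \<open>C\<close>, started at time \<open>0\<close> in its
  stationary distribution \<open>\<pi>\<close>.
  \<^item> \<open>T k i\<close> is the arrival time of the \<open>i\<close>-th class-\<open>k\<close> customer after time \<open>0\<close>, and
    \<open>Z k i\<close> is that customer's pair (reservation time, service time), with law \<open>p k\<close>.
  \<^item> \<open>B t\<close> is the booking profile at time \<open>t\<close>, made up of the reservations of the
    customers who arrived strictly before \<open>t\<close>; \<open>B 0\<close> comes from the customers who
    arrived before time \<open>0\<close>.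

  The equation \<open>dynamics\<close> determines \<open>B\<close> from \<open>B 0\<close>, \<open>T\<close> and \<open>Z\<close> recursively along the arrival
  times: the customer arriving at \<open>T k i\<close> is judged by the profile \<open>B (T k i)\<close> and, if admitted,
  holds a unit during \<open>[T k i + d, T k i + d + s]\<close>. The last assumption says that \<open>\<pi>\<close> is
  invariant for the booking-profile process.\<close>

locale stationary_loss_network = prob_space M
  for M :: "'a measure" +
  fixes K :: nat
    and u v :: "nat \<Rightarrow> nat"
    and p :: "nat \<Rightarrow> (nat \<times> nat) pmf"
    and rate :: "nat \<Rightarrow> real"
    and C :: nat
    and T :: "nat \<Rightarrow> nat \<Rightarrow> 'a \<Rightarrow> real"
    and Z :: "nat \<Rightarrow> nat \<Rightarrow> 'a \<Rightarrow> nat \<times> nat"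
    and B :: "real \<Rightarrow> 'a \<Rightarrow> real \<Rightarrow> nat"
    and \<pi> :: "(real \<Rightarrow> nat) measure"
  assumes rate_pos: "\<And>k. k \<in> {1..K} \<Longrightarrow> 0 < rate k"
    and request_range: "\<And>k. k \<in> {1..K} \<Longrightarrow> set_pmf (p k) \<subseteq> {0..u k} \<times> {1..v k}"
    and arrivals: "\<And>k. k \<in> {1..K} \<Longrightarrow> poisson_process (rate k) (T k)"
    and request_measurable:
      "\<And>k i. k \<in> {1..K} \<Longrightarrow> random_variable (count_space UNIV) (Z k i)"
    and request_law:
      "\<And>k i. k \<in> {1..K} \<Longrightarrow> distr M (count_space UNIV) (Z k i) = measure_pmf (p k)"
    and profile_measurable: "\<And>t. 0 \<le> t \<Longrightarrow> random_variable profile_algebra (B t)"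
    and independence:
      "indep_sets
         (\<lambda>j. case j of
            Initial \<Rightarrow> sets (vimage_algebra (space M) (B 0) profile_algebra)
          | Arrivals k \<Rightarrow> sets (vimage_algebra (space M) (\<lambda>\<omega> i. T k i \<omega>) (\<Pi>\<^sub>M i\<in>UNIV. borel))
          | Request k i \<Rightarrow> sets (vimage_algebra (space M) (Z k i) (count_space UNIV)))
         ({Initial} \<union> {Arrivals k | k. k \<in> {1..K}} \<union> {Request k i | k i. k \<in> {1..K}})"
    and initial_profile: "AE \<omega> in M. B 0 \<omega> \<in> booking_profiles K p C"
    and dynamics:
      "AE \<omega> in M. \<forall>t\<ge>0. \<forall>x\<ge>0.
         B t \<omega> x = B 0 \<omega> (t + x) +
           card {(k, i). k \<in> {1..K} \<and> T k i \<omega> < t \<and>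
             (case Z k i \<omega> of (d, s) \<Rightarrow>
                admits C (B (T k i \<omega>) \<omega>) d s \<and>
                T k i \<omega> + real d \<le> t + x \<and> t + x \<le> T k i \<omega> + real d + real s)}"
    and stationary: "\<And>t. 0 \<le> t \<Longrightarrow> distr M profile_algebra (B t) = \<pi>"

text \<open>The stationary blocking probability of customers with reservation time \<open>d\<close> and service
  time \<open>s\<close>. A customer arriving at a random time sees the stationary profile, and whether the
  customer is admitted depends on the class only through \<open>(d, s)\<close>; so all classes that can
  issue the request \<open>(d, s)\<close> share this value.\<close>

definition blocking_prob :: "(real \<Rightarrow> nat) measure \<Rightarrow> nat \<Rightarrow> nat \<Rightarrow> nat \<Rightarrow> real" where
  "blocking_prob \<pi> C d s = measure \<pi> {f. \<not> admits C f d s}"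

definition traffic_intensity ::
    "nat \<Rightarrow> (nat \<Rightarrow> real) \<Rightarrow> (nat \<Rightarrow> (nat \<times> nat) pmf) \<Rightarrow> real" where
  "traffic_intensity K rate p =
     (\<Sum>k=1..K. rate k * measure_pmf.expectation (p k) (\<lambda>(d, s). real s))"

end

theory Submission
  imports Defs "HOL-Real_Asymp.Real_Asymp"
begin

text \<open>Turning customers away only removes reservations, and a reservation made more than \<open>W\<close> time
units ago has ended, where \<open>W\<close> bounds all \<open>d + s\<close>. In equilibrium the booking profile is therefore
dominated by what the customers of the last \<open>W + 1\<close> time units would have reserved if all of them
had been admitted (\<open>blocking_prob_le_union\<close>). This unlimited system is a functional of a marked
Poisson process, and the difficult feedback of the admission rule disappears. The price is that only
upper bounds come out, which is all that is claimed.

In the unlimited system the number of units reserved \<open>x\<close> time units ahead has a Poisson law whose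
mean is \<open>\<rho>\<close> up to the smallest possible reservation time \<open>a\<close> and strictly smaller beyond it: looking
past \<open>a\<close>, the customers with reservation time \<open>a\<close> who will start there have not arrived yet. A
request \<open>(d, s)\<close> looks at the moments in \<open>[d, d + s]\<close> only, and \<open>a \<le> d\<close>.

The maximum over a continuum of moments is reduced to a finite one: with a grid of step
\<open>1/m\<close>, count for each grid cell the reservations that could meet the cell. As \<open>d\<close> and \<open>s\<close> are integers,
whether this happens depends only on \<open>(d, s)\<close> and on the cell of length \<open>1/m\<close> that contains the age
of the reservation. The counts are again Poisson; their means exceed \<open>\<rho>\<close> by at most \<open>2/m\<close> times the total
arrival rate \<open>\<Lambda>\<close>, and \<open>\<Lambda> \<le> \<rho>\<close> because service times are at least \<open>1\<close>.

If \<open>C = (1 + \<epsilon>) \<rho>\<close>, a fixed \<open>m\<close> with \<open>2/m \<le> \<epsilon>/2\<close> suffices: each of the finitely many Poisson counts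
exceeds \<open>C\<close> with exponentially small probability (\<open>blocking_prob_le_exponential\<close>).

If \<open>C = \<rho>\<close>, take \<open>m = C\<close>, so that the count \<open>N\<^sub>0\<close> at the moment \<open>a\<close> is Poisson with mean between \<open>C\<close> and
\<open>C + 2\<close>. The counts at later cells may be larger than \<open>N\<^sub>0\<close>, but the difference has a negative drift
of at least a fixed multiple of its variance, hence an exponential moment that is at most \<open>1\<close> for every cell
(\<open>prob_point_count_growth\<close>). So with high probability no count exceeds \<open>N\<^sub>0\<close> by more than
\<open>C powr (1/4)\<close>, which is negligible against the standard deviation \<open>sqrt C\<close> of \<open>N\<^sub>0\<close>. By the
central limit theorem \<open>N\<^sub>0\<close> reaches \<open>C - C powr (1/4)\<close> with a probability that tends to
\<open>1/2\<close> (\<open>limsup_poisson_tail_le_half\<close>, \<open>blocking_prob_le_poisson_tail\<close>).\<close>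

section \<open>The Poisson distribution\<close>

lemma nn_integral_power_poisson:
  assumes "0 < r" "0 \<le> x"
  shows "(\<integral>\<^sup>+n. ennreal x ^ n \<partial>measure_pmf (poisson_pmf r)) = ennreal (exp (r * (x - 1)))"
proof -
  have s: "(\<lambda>n. (r * x) ^ n / fact n * exp (- r)) sums (exp (r * x) * exp (- r))"
    using exp_converges[of "r * x"] by (intro sums_mult2) (simp add: divide_inverse mult.commute)
  have "(\<integral>\<^sup>+n. ennreal x ^ n \<partial>measure_pmf (poisson_pmf r))
      = (\<integral>\<^sup>+n. ennreal ((r * x) ^ n / fact n * exp (- r)) \<partial>count_space UNIV)"
    using assms by (subst nn_integral_measure_pmf, intro nn_integral_cong)
      (simp add: ennreal_power ennreal_mult[symmetric] power_mult_distrib field_simps)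
  also have "\<dots> = (\<Sum>n. ennreal ((r * x) ^ n / fact n * exp (- r)))"
    by (simp add: nn_integral_count_space_nat)
  also have "\<dots> = ennreal (exp (r * x) * exp (- r))"
    using assms s by (subst suminf_ennreal2) (auto simp: sums_iff)
  also have "exp (r * x) * exp (- r) = exp (r * (x - 1))"
    by (simp add: mult_exp_exp algebra_simps)
  finally show ?thesis .
qed

text \<open>The identity theorem for power series, on one side of the expansion point only: generating functions
of counts are known for arguments in \<open>(0, 1)\<close>. Once the coefficients below \<open>n\<close> vanish, the series
divided by \<open>z ^ n\<close> tends to the coefficient \<open>a n\<close> as \<open>z\<close> decreases to \<open>0\<close>.\<close>

lemma powser_coeffs_zero_of_vanishing:
  fixes a :: "nat \<Rightarrow> real"
  assumes "\<And>z. 0 < z \<Longrightarrow> z < 1 \<Longrightarrow> (\<lambda>n. a n * z ^ n) sums 0"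
    and bound: "\<And>n. \<bar>a n\<bar> \<le> 1"
  shows "a n = 0"
proof (induction n rule: less_induct)
  case (less n)
  let ?f = "\<lambda>z. \<Sum>k. a (k + n) * z ^ k"
  have summ: "(\<lambda>k. a (k + n) * z ^ k) sums ?f z" if "norm z < 1" for z
  proof -
    have "summable (\<lambda>k. norm z ^ k)" using that by (simp add: summable_geometric)
    then have "summable (\<lambda>k. a (k + n) * z ^ k)"
      by (rule summable_comparison_test'[of _ 0]) (use mult_right_mono[OF bound] in \<open>auto simp: abs_mult power_abs\<close>)
    then show ?thesis by (rule summable_sums)
  qed
  have zero: "?f z = 0" if "0 < z" "z < 1" for z
  proof -
    have "(\<lambda>k. a k * z ^ k) sums 0" using that by (rule assms(1))
    then have "(\<lambda>k. a (k + n) * z ^ (k + n)) sums (0 - (\<Sum>k<n. a k * z ^ k))"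
      by (rule sums_split_initial_segment)
    then have "(\<lambda>k. z ^ n * (a (k + n) * z ^ k)) sums 0"
      using less by (simp add: power_add mult_ac)
    moreover have "(\<lambda>k. z ^ n * (a (k + n) * z ^ k)) sums (z ^ n * ?f z)"
      using that by (intro sums_mult summ) simp
    ultimately have "z ^ n * ?f z = 0" by (rule sums_unique2[symmetric])
    then show ?thesis using that by simp
  qed
  have "(?f \<longlongrightarrow> a (0 + n)) (at 0)"
    by (rule powser_limit_0_strong[of 1]) (use summ in auto)
  then have "(?f \<longlongrightarrow> a n) (at_right 0)"
    by (simp add: filterlim_at_split)
  moreover have "(?f \<longlongrightarrow> 0) (at_right 0)"
    by (rule tendsto_eventually) (use zero in \<open>auto simp: eventually_at_right_field intro!: exI[of _ 1]\<close>)
  ultimately show ?case by (intro tendsto_unique[of "at_right 0" ?f]) auto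
qed

text \<open>Generating functions identify the law of a count. Real arguments in \<open>(0, 1)\<close> suffice, so that
everything can be computed with nonnegative integrals.\<close>

lemma (in prob_space) poisson_of_generating_function:
  fixes X :: "'a \<Rightarrow> nat"
  assumes X[measurable]: "random_variable (count_space UNIV) X" and "0 < r"
    and gf: "\<And>z. 0 < z \<Longrightarrow> z < 1 \<Longrightarrow> (\<integral>\<^sup>+\<omega>. ennreal z ^ X \<omega> \<partial>M) = ennreal (exp (r * (z - 1)))"
  shows "distr M (count_space UNIV) X = measure_pmf (poisson_pmf r)"
proof -
  define b where "b n = prob (X -` {n} \<inter> space M)" for n
  define a where "a n = b n - pmf (poisson_pmf r) n" for n
  have sing: "X -` {n} \<inter> space M \<in> events" for n
    by (rule measurable_sets[OF X]) simp
  have b: "0 \<le> b n" "b n \<le> 1" for n by (auto simp: b_def)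
  have "a n = 0" for n
  proof (rule powser_coeffs_zero_of_vanishing)
    show "\<bar>a n\<bar> \<le> 1" for n
      using b[of n] pmf_nonneg[of "poisson_pmf r" n] pmf_le_1[of "poisson_pmf r" n] unfolding a_def by linarith
    fix z :: real assume z: "0 < z" "z < 1"
    have geo: "summable (\<lambda>n. z ^ n)" using z by (simp add: summable_geometric)
    have series: "(\<lambda>n. c n * z ^ n) sums x"
      if c: "\<And>n. 0 \<le> c n" "\<And>n. c n \<le> 1" and x: "0 \<le> x"
        and eq: "(\<Sum>n. ennreal (c n * z ^ n)) = ennreal x" for c x
    proof -
      have s: "summable (\<lambda>n. c n * z ^ n)"
        by (rule summable_comparison_test'[OF geo, of 0])
          (use mult_right_mono[OF c(2)] c(1) z in \<open>auto simp: abs_mult\<close>)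
      then have "(\<Sum>n. ennreal (c n * z ^ n)) = ennreal (\<Sum>n. c n * z ^ n)"
        using c z by (intro suminf_ennreal2) auto
      then have "ennreal (\<Sum>n. c n * z ^ n) = ennreal x"
        using eq by (rule trans[OF sym])
      moreover have "0 \<le> (\<Sum>n. c n * z ^ n)"
        using c(1) z(1) by (intro suminf_nonneg[OF s] mult_nonneg_nonneg zero_le_power) simp_all
      ultimately have "(\<Sum>n. c n * z ^ n) = x"
        using x by (rule ennreal_inj[THEN iffD1, rotated 2])
      then show ?thesis using summable_sums[OF s] by (rule subst)
    qed
    have "(\<integral>\<^sup>+\<omega>. ennreal z ^ X \<omega> \<partial>M) = (\<integral>\<^sup>+\<omega>. (\<Sum>n. ennreal (z ^ n) * indicator (X -` {n} \<inter> space M) \<omega>) \<partial>M)"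
    proof (rule nn_integral_cong)
      fix \<omega> assume "\<omega> \<in> space M"
      then have "(\<Sum>n. ennreal (z ^ n) * indicator (X -` {n} \<inter> space M) \<omega>)
          = (\<Sum>n\<in>{X \<omega>}. ennreal (z ^ n) * indicator (X -` {n} \<inter> space M) \<omega>)"
        by (intro suminf_finite) (auto simp: indicator_def)
      then show "ennreal z ^ X \<omega> = (\<Sum>n. ennreal (z ^ n) * indicator (X -` {n} \<inter> space M) \<omega>)"
        using \<open>\<omega> \<in> space M\<close> z by (simp add: ennreal_power)
    qed
    also have "\<dots> = (\<Sum>n. ennreal (b n * z ^ n))"
      using z sing by (subst nn_integral_suminf)
        (auto intro!: borel_measurable_times_ennreal borel_measurable_indicator simp: nn_integral_cmult_indicator emeasure_eq_measure b_def ennreal_mult'' mult.commute)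
    finally have "(\<lambda>n. b n * z ^ n) sums exp (r * (z - 1))"
      using gf[OF z] b by (intro series) auto
    moreover have "(\<lambda>n. pmf (poisson_pmf r) n * z ^ n) sums exp (r * (z - 1))"
    proof -
      have "(\<lambda>n. (r * z) ^ n /\<^sub>R fact n * exp (- r)) sums (exp (r * z) * exp (- r))"
        by (intro sums_mult2 exp_converges)
      then show ?thesis
        using \<open>0 < r\<close> by (simp add: mult_exp_exp power_mult_distrib divide_inverse algebra_simps)
    qed
    ultimately have "(\<lambda>n. b n * z ^ n - pmf (poisson_pmf r) n * z ^ n) sums (exp (r * (z - 1)) - exp (r * (z - 1)))"
      by (rule sums_diff)
    then show "(\<lambda>n. a n * z ^ n) sums 0" by (simp add: a_def left_diff_distrib)
  qed
  then have eq: "b n = pmf (poisson_pmf r) n" for n by (simp add: a_def)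
  show ?thesis
  proof (rule measure_eqI_countable[where A = UNIV])
    fix n
    show "emeasure (distr M (count_space UNIV) X) {n} = emeasure (measure_pmf (poisson_pmf r)) {n}"
      using eq[of n] by (simp add: emeasure_distr emeasure_eq_measure b_def emeasure_pmf_single)
  qed auto
qed

lemma measure_std_normal_singleton: "measure std_normal_distribution {x} = 0"
proof -
  have "emeasure std_normal_distribution {x} = (\<integral>\<^sup>+u. std_normal_density u * indicator {x} u \<partial>lborel)"
    by (subst emeasure_density) (auto simp: ennreal_indicator ennreal_mult' intro!: nn_integral_cong)
  also have "\<dots> = 0"
    using AE_lborel_singleton[of x]
    by (subst nn_integral_0_iff_AE) (auto elim!: eventually_mono)
  finally show ?thesis by (simp add: measure_def)
qed

text \<open>The limit value \<open>1/2\<close> comes from the symmetry of the normal density.\<close>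

lemma cdf_std_normal_distribution_0: "cdf std_normal_distribution 0 = 1 / 2"
proof -
  interpret real_distribution std_normal_distribution by (rule real_dist_normal_dist)
  let ?N = "std_normal_distribution"
  have "emeasure ?N {..0} = (\<integral>\<^sup>+x. std_normal_density x * indicator {..0} x \<partial>lborel)"
    by (subst emeasure_density) (auto simp: ennreal_indicator ennreal_mult' intro!: nn_integral_cong)
  also have "\<dots> = (\<integral>\<^sup>+x. std_normal_density (- x) * indicator {..0} (- x) \<partial>lborel)"
    by (subst nn_integral_real_affine[where c = "-1" and t = 0]) auto
  also have "\<dots> = (\<integral>\<^sup>+x. std_normal_density x * indicator {0..} x \<partial>lborel)"
    by (intro nn_integral_cong) (auto simp: std_normal_density_def indicator_def)
  also have "\<dots> = emeasure ?N {0..}"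
    by (subst emeasure_density) (auto simp: ennreal_indicator ennreal_mult' intro!: nn_integral_cong)
  finally have "emeasure ?N {..0} = emeasure ?N {0..}" .
  then have "measure ?N {..0} = measure ?N {0..}" by (simp add: measure_def)
  moreover have "measure ?N {0} = 0" by (rule measure_std_normal_singleton)
  moreover have "measure ?N {..0} + measure ?N {0<..} = measure ?N ({..0} \<union> {0<..})"
    by (subst finite_measure_Union) auto
  moreover have "measure ?N {0} + measure ?N {0<..} = measure ?N ({0} \<union> {0<..})"
    by (subst finite_measure_Union) auto
  moreover have "{..0} \<union> {0<..} = (UNIV :: real set)" "{0} \<union> {0<..} = {0::real..}" by auto
  moreover have "measure ?N UNIV = 1" using prob_space by simp
  ultimately show ?thesis by (simp add: cdf_def)
qed

lemma integral_power_poisson: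
  fixes z :: complex
  assumes "0 < r"
  shows "(\<integral>n. z ^ n \<partial>measure_pmf (poisson_pmf r)) = exp (of_real r * (z - 1))"
proof -
  have s: "(\<lambda>n. pmf (poisson_pmf r) n *\<^sub>R z ^ n) sums (exp (of_real r * z) * exp (- of_real r))"
  proof -
    have "(\<lambda>n. (of_real r * z) ^ n /\<^sub>R fact n * exp (- of_real r)) sums (exp (of_real r * z) * exp (- of_real r))"
      by (intro sums_mult2 exp_converges)
    moreover have "(of_real r * z) ^ n /\<^sub>R fact n * exp (- of_real r) = pmf (poisson_pmf r) n *\<^sub>R z ^ n" for n
      using assms by (simp add: scaleR_conv_of_real power_mult_distrib exp_of_real[symmetric] field_simps flip: of_real_minus)
    ultimately show ?thesis by simp
  qed
  have "summable (\<lambda>n. norm (pmf (poisson_pmf r) n *\<^sub>R z ^ n))"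
  proof -
    have "summable (\<lambda>n. (r * norm z) ^ n /\<^sub>R fact n * exp (- r))"
      by (intro summable_mult2 summable_exp_generic)
    moreover have "(r * norm z) ^ n /\<^sub>R fact n * exp (- r) = norm (pmf (poisson_pmf r) n *\<^sub>R z ^ n)" for n
      using assms by (simp add: norm_mult norm_power power_mult_distrib divide_inverse mult_ac)
    ultimately show ?thesis by simp
  qed
  then have int: "integrable (count_space UNIV) (\<lambda>n. pmf (poisson_pmf r) n *\<^sub>R z ^ n)"
    by (simp add: integrable_count_space_nat_iff)
  have "(\<integral>n. z ^ n \<partial>measure_pmf (poisson_pmf r)) = (\<integral>n. pmf (poisson_pmf r) n *\<^sub>R z ^ n \<partial>count_space UNIV)"
    unfolding measure_pmf_eq_density by (subst integral_density) auto
  also have "\<dots> = exp (of_real r * z) * exp (- of_real r)"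
    using s by (subst integral_count_space_nat[OF int]) (simp add: sums_iff)
  finally show ?thesis by (simp add: mult_exp_exp algebra_simps)
qed

lemma iexp_quadratic_approx: "cmod (iexp x - (1 + \<i> * of_real x - of_real (x\<^sup>2 / 2))) \<le> \<bar>x\<bar> ^ 3 / 6"
proof -
  have "{..2::nat} = {0, 1, 2}" by auto
  then have "(\<Sum>k\<le>2. (\<i> * complex_of_real x) ^ k / fact k) = 1 + \<i> * of_real x - of_real (x\<^sup>2 / 2)"
    by (simp add: power_mult_distrib)
  then show ?thesis
    using iexp_approx1[of x 2] by (simp add: fact_numeral)
qed

text \<open>The standardised Poisson law has characteristic function
\<open>exp (r (exp (i \<theta>) - 1 - i \<theta>))\<close> with \<open>\<theta> = t / sqrt r\<close>; the quadratic Taylor term contributes exactly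
\<open>- t\<^sup>2 / 2\<close> and the remainder is at most \<open>\<bar>t\<bar>\<^sup>3 / (6 sqrt r)\<close>. The parameter need not be an integer,
so the theorem for sums of identically distributed variables does not apply directly.\<close>

lemma poisson_central_limit:
  assumes r: "filterlim r at_top sequentially" and pos: "\<And>n. 0 < r n"
  shows "weak_conv_m (\<lambda>n. distr (measure_pmf (poisson_pmf (r n))) borel (\<lambda>j. (real j - r n) / sqrt (r n)))
           std_normal_distribution"
proof (rule levy_continuity)
  show "real_distribution (distr (measure_pmf (poisson_pmf (r n))) borel (\<lambda>j. (real j - r n) / sqrt (r n)))" for n
    by (rule prob_space.real_distribution_distr) (auto intro: measure_pmf.prob_space_axioms)
  show "real_distribution std_normal_distribution" by (rule real_dist_normal_dist)
  fix t :: real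
  let ?\<theta> = "\<lambda>n. t / sqrt (r n)"
  let ?e = "\<lambda>n. of_real (r n) * (iexp (?\<theta> n) - 1 - \<i> * of_real (?\<theta> n)) :: complex"
  have char_eq: "char (distr (measure_pmf (poisson_pmf (r n))) borel (\<lambda>j. (real j - r n) / sqrt (r n))) t
      = exp (?e n)" for n
  proof -
    \<comment> \<open>Separates the deterministic centring from a power of a fixed complex number.\<close>
    have split: "iexp (t * ((real j - r n) / sqrt (r n))) = iexp (- t * sqrt (r n)) * iexp (?\<theta> n) ^ j" for j
    proof -
      have "t * ((real j - r n) / sqrt (r n)) = - t * sqrt (r n) + real j * ?\<theta> n"
        using pos[of n] by (simp add: diff_divide_distrib right_diff_distrib real_div_sqrt)
      then have "iexp (t * ((real j - r n) / sqrt (r n))) = exp (\<i> * of_real (- t * sqrt (r n)) + of_nat j * (\<i> * of_real (?\<theta> n)))"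
        by (simp only: of_real_add of_real_mult of_real_of_nat_eq distrib_left mult.left_commute)
      then show ?thesis
        by (simp only: exp_add exp_of_nat_mult)
    qed
    have "char (distr (measure_pmf (poisson_pmf (r n))) borel (\<lambda>j. (real j - r n) / sqrt (r n))) t
        = (\<integral>j. iexp (t * ((real j - r n) / sqrt (r n))) \<partial>measure_pmf (poisson_pmf (r n)))"
      unfolding char_def by (subst integral_distr) auto
    also have "\<dots> = iexp (- t * sqrt (r n)) * exp (of_real (r n) * (iexp (?\<theta> n) - 1))"
      unfolding split using pos[of n] by (simp add: integral_power_poisson)
    also have "\<dots> = exp (?e n)"
    proof -
      have "r n * ?\<theta> n = t * sqrt (r n)"
        using pos[of n] real_div_sqrt[of "r n"] times_divide_eq_right[of t "r n" "sqrt (r n)"]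
        by (simp add: mult.commute)
      then have "complex_of_real (r n) * complex_of_real (?\<theta> n) = complex_of_real (t * sqrt (r n))"
        by (simp only: of_real_mult[symmetric])
      then have "\<i> * of_real (- t * sqrt (r n)) + of_real (r n) * (iexp (?\<theta> n) - 1) = ?e n"
        by (simp only: right_diff_distrib mult.left_commute[of _ \<i>] of_real_minus mult_minus_left mult_minus_right) simp
      then show ?thesis by (simp only: exp_add[symmetric])
    qed
    finally show ?thesis .
  qed
  have "(\<lambda>n. ?e n) \<longlonglongrightarrow> complex_of_real (- t\<^sup>2 / 2)"
  proof (rule Lim_transform2)
    show "(\<lambda>n. complex_of_real (- t\<^sup>2 / 2)) \<longlonglongrightarrow> complex_of_real (- t\<^sup>2 / 2)" by simp
    have bound: "norm (complex_of_real (- t\<^sup>2 / 2) - ?e n) \<le> \<bar>t\<bar> ^ 3 / 6 / sqrt (r n)" for n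
    proof -
      have rt: "r n * ((?\<theta> n)\<^sup>2 / 2) = t\<^sup>2 / 2"
        using pos[of n] by (simp add: power_divide)
      have "complex_of_real (- t\<^sup>2 / 2) - ?e n
          = - of_real (r n) * (iexp (?\<theta> n) - (1 + \<i> * of_real (?\<theta> n) - of_real ((?\<theta> n)\<^sup>2 / 2)))"
        unfolding minus_divide_left[symmetric] rt[symmetric] of_real_minus of_real_mult
        by (simp only: right_diff_distrib distrib_left mult_minus_left) simp
      then have "norm (complex_of_real (- t\<^sup>2 / 2) - ?e n)
          = r n * cmod (iexp (?\<theta> n) - (1 + \<i> * of_real (?\<theta> n) - of_real ((?\<theta> n)\<^sup>2 / 2)))"
        using pos[of n] by (simp only: norm_mult norm_minus_cancel norm_of_real abs_of_pos)
      also have "\<dots> \<le> r n * (\<bar>?\<theta> n\<bar> ^ 3 / 6)"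
        using pos[of n] by (intro mult_left_mono iexp_quadratic_approx) simp
      also have "\<dots> = \<bar>t\<bar> ^ 3 / 6 / sqrt (r n)"
      proof -
        have "sqrt (r n) ^ 3 = r n * sqrt (r n)" using pos[of n] by (simp add: power3_eq_cube)
        then show ?thesis using pos[of n] by (simp add: power_divide abs_divide)
      qed
      finally show ?thesis .
    qed
    have "(\<lambda>n. \<bar>t\<bar> ^ 3 / 6 / sqrt (r n)) \<longlonglongrightarrow> 0"
      by (intro tendsto_divide_0[OF tendsto_const] filterlim_at_top_imp_at_infinity
            filterlim_compose[OF sqrt_at_top r])
    then show "(\<lambda>n. complex_of_real (- t\<^sup>2 / 2) - ?e n) \<longlonglongrightarrow> 0"
      by (rule Lim_null_comparison[OF always_eventually, rotated]) (use bound in blast)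
  qed
  then have "(\<lambda>n. exp (?e n)) \<longlonglongrightarrow> exp (complex_of_real (- t\<^sup>2 / 2))"
    by (rule tendsto_exp)
  then show "(\<lambda>n. char (distr (measure_pmf (poisson_pmf (r n))) borel (\<lambda>j. (real j - r n) / sqrt (r n))) t)
      \<longlonglongrightarrow> char std_normal_distribution t"
    by (simp only: char_eq char_std_normal_distribution exp_of_real)
qed

text \<open>A shift of the threshold by \<open>o(sqrt r)\<close> is invisible in the central limit theorem: it is eventually
smaller than \<open>\<delta> sqrt r\<close> for every \<open>\<delta> > 0\<close>, and the normal distribution function is continuous at \<open>0\<close>.\<close>

lemma limsup_poisson_tail_le_half:
  assumes r: "filterlim r at_top sequentially" and pos: "\<And>n. 0 < r n"
    and y: "(\<lambda>n. y n / sqrt (r n)) \<longlonglongrightarrow> 0"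
  shows "limsup (\<lambda>n. ereal (measure_pmf.prob (poisson_pmf (r n)) {j. r n - y n \<le> real j})) \<le> ereal (1 / 2)"
proof (rule ereal_le_epsilon2)
  fix e :: real assume "0 < e"
  let ?F = "cdf std_normal_distribution"
  interpret N: real_distribution std_normal_distribution by (rule real_dist_normal_dist)
  have cont: "isCont ?F x" for x
    by (simp add: N.isCont_cdf measure_std_normal_singleton)
  obtain \<delta> where \<delta>: "0 < \<delta>" "\<bar>?F (- \<delta>) - 1 / 2\<bar> < e"
  proof -
    obtain d where d: "0 < d" "\<And>x. \<bar>x\<bar> < d \<Longrightarrow> \<bar>?F x - ?F 0\<bar> < e"
      using cont[of 0] \<open>0 < e\<close> unfolding continuous_at_eps_delta by (auto simp: dist_real_def)
    show thesis using d(1) d(2)[of "- (d / 2)"] by (intro that[of "d / 2"]) (auto simp: cdf_std_normal_distribution_0)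
  qed
  define D where "D n = distr (measure_pmf (poisson_pmf (r n))) borel (\<lambda>j. (real j - r n) / sqrt (r n))" for n
  have lim: "(\<lambda>n. 1 - cdf (D n) (- \<delta>)) \<longlonglongrightarrow> 1 - ?F (- \<delta>)"
    using poisson_central_limit[OF r pos] cont unfolding weak_conv_m_def weak_conv_def D_def
    by (intro tendsto_diff tendsto_const) blast
  have "eventually (\<lambda>n. y n / sqrt (r n) < \<delta>) sequentially"
    using y \<delta>(1) by (rule order_tendstoD)
  then have "eventually (\<lambda>n. ereal (measure_pmf.prob (poisson_pmf (r n)) {j. r n - y n \<le> real j}) \<le> ereal (1 - cdf (D n) (- \<delta>))) sequentially"
  proof eventually_elim
    case (elim n)
    have "cdf (D n) (- \<delta>) = measure_pmf.prob (poisson_pmf (r n)) {j. (real j - r n) / sqrt (r n) \<le> - \<delta>}"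
      unfolding cdf_def D_def by (subst measure_distr) (auto simp: vimage_def)
    then have "1 - cdf (D n) (- \<delta>) = measure_pmf.prob (poisson_pmf (r n)) (- {j. (real j - r n) / sqrt (r n) \<le> - \<delta>})"
      by (simp add: measure_pmf.prob_compl[symmetric] Compl_eq_Diff_UNIV)
    moreover have "{j. r n - y n \<le> real j} \<subseteq> - {j. (real j - r n) / sqrt (r n) \<le> - \<delta>}"
    proof
      fix j assume "j \<in> {j. r n - y n \<le> real j}"
      then have "- y n / sqrt (r n) \<le> (real j - r n) / sqrt (r n)"
        using pos[of n] by (intro divide_right_mono) auto
      then show "j \<in> - {j. (real j - r n) / sqrt (r n) \<le> - \<delta>}" using elim by simp
    qed
    ultimately show ?case by (simp add: measure_pmf.finite_measure_mono)
  qed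
  then have "limsup (\<lambda>n. ereal (measure_pmf.prob (poisson_pmf (r n)) {j. r n - y n \<le> real j}))
      \<le> limsup (\<lambda>n. ereal (1 - cdf (D n) (- \<delta>)))"
    by (rule Limsup_mono)
  also have "\<dots> = ereal (1 - ?F (- \<delta>))"
    using lim by (intro lim_imp_Limsup) auto
  also have "\<dots> \<le> ereal (1 / 2) + ereal e" using \<delta>(2) by simp
  finally show "limsup (\<lambda>n. ereal (measure_pmf.prob (poisson_pmf (r n)) {j. r n - y n \<le> real j})) \<le> ereal (1 / 2) + ereal e" .
qed

section \<open>Generating functions of the arrivals\<close>

lemma (in prob_space) poisson_processD:
  assumes "poisson_process r T"
  shows "random_variable borel (T i)"
    and "AE \<omega> in M. 0 < T 0 \<omega> \<and> strict_mono (\<lambda>i. T i \<omega>) \<and>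
                 filterlim (\<lambda>i. T i \<omega>) at_top sequentially"
    and "0 \<le> a \<Longrightarrow> a < b \<Longrightarrow> distr M (count_space UNIV) (\<lambda>\<omega>. card {i. a < T i \<omega> \<and> T i \<omega> \<le> b})
          = measure_pmf (poisson_pmf (r * (b - a)))"
    and "0 \<le> \<tau> 0 \<Longrightarrow> mono \<tau> \<Longrightarrow> indep_vars (\<lambda>_. count_space UNIV)
          (\<lambda>j \<omega>. card {i. \<tau> j < T i \<omega> \<and> T i \<omega> \<le> \<tau> (Suc j)}) UNIV"
  using assms unfolding poisson_process_def by (blast, blast, blast, blast)

text \<open>The points are enumerated in increasing order, so those up to \<open>t\<close> form an initial segment of the
indices.\<close>

lemma (in prob_space) poisson_process_finite_front:
  assumes "poisson_process r T"
  shows "AE \<omega> in M. \<exists>n. \<forall>i. T i \<omega> \<le> t \<longleftrightarrow> i < n"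
proof -
  have "AE \<omega> in M. strict_mono (\<lambda>i. T i \<omega>) \<and> filterlim (\<lambda>i. T i \<omega>) at_top sequentially"
    using poisson_processD(2)[OF assms] by eventually_elim simp
  then show ?thesis
  proof eventually_elim
    case (elim \<omega>)
    then have sm: "strict_mono (\<lambda>i. T i \<omega>)" by simp
    obtain N where N: "\<And>i. i \<ge> N \<Longrightarrow> T i \<omega> > t"
      using elim by (auto simp: filterlim_at_top_dense eventually_sequentially)
    define n where "n = (LEAST i. T i \<omega> > t)"
    have "T n \<omega> > t" unfolding n_def by (rule LeastI[of _ N]) (simp add: N)
    then have "T i \<omega> > t" if "i \<ge> n" for i
      using that sm by (meson less_le_trans strict_mono_less_eq)
    moreover have "T i \<omega> \<le> t" if "i < n" for i
      using not_less_Least that unfolding n_def by (metis not_less)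
    ultimately show ?case by (intro exI[of _ n]) (metis not_less)
  qed
qed

text \<open>The cells are indexed by age, that is, backwards from the time \<open>t\<close> of observation: cell \<open>r\<close> holds the
arrivals whose age \<open>t - \<tau>\<close> lies in \<open>[r/m, (r + 1)/m)\<close>. In the first \<open>t\<close> time units there are
\<open>m * t\<close> of them.\<close>

definition age_cell :: "nat \<Rightarrow> nat \<Rightarrow> real \<Rightarrow> nat" where
  "age_cell m t \<tau> = nat \<lfloor>real m * (real t - \<tau>)\<rfloor>"

lemma age_cell_eq:
  assumes "0 < m" "j < m * t" "real j / real m < \<tau>" "\<tau> \<le> real (Suc j) / real m"
  shows "age_cell m t \<tau> = m * t - Suc j"
proof -
  have "real j < m * \<tau>" "m * \<tau> \<le> real j + 1"
    using assms by (auto simp: field_simps)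
  then have "\<lfloor>real m * (real t - \<tau>)\<rfloor> = int (m * t - Suc j)"
    using assms(2) by (intro floor_unique) (auto simp: algebra_simps of_nat_diff)
  then show ?thesis by (simp add: age_cell_def)
qed

lemma measurable_age_cell[measurable]: "age_cell m t \<in> borel \<rightarrow>\<^sub>M count_space UNIV"
  unfolding age_cell_def[abs_def] by measurable

text \<open>The product over the arrivals of a step function of their age is a product over cells of
powers, whose exponents are independent Poisson counts with mean \<open>r / m\<close>.\<close>

lemma (in prob_space) poisson_process_prod_step:
  fixes \<phi> :: "nat \<Rightarrow> real"
  assumes pp: "poisson_process r T" and "0 < r" and "0 < m" and \<phi>: "\<And>j. 0 \<le> \<phi> j"
  shows "(\<integral>\<^sup>+\<omega>. (\<Prod>i\<in>{i. T i \<omega> \<le> real t}. ennreal (\<phi> (age_cell m t (T i \<omega>)))) \<partial>M)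
       = ennreal (exp (r / real m * (\<Sum>j<m * t. \<phi> j - 1)))"
proof -
  let ?R = "m * t"
  define N where "N j \<omega> = card {i. real j / real m < T i \<omega> \<and> T i \<omega> \<le> real (Suc j) / real m}" for j \<omega>
  have "mono (\<lambda>j. real j / real m)" by (intro monoI divide_right_mono) auto
  then have indep_N: "indep_vars (\<lambda>_. count_space UNIV) N UNIV"
    unfolding N_def[abs_def] by (intro poisson_processD(4)[OF pp]) auto
  have "AE \<omega> in M. 0 < T 0 \<omega> \<and> strict_mono (\<lambda>i. T i \<omega>)"
    using poisson_processD(2)[OF pp] by eventually_elim simp
  with poisson_process_finite_front[OF pp, of "real t"]
  have "AE \<omega> in M. (\<Prod>i\<in>{i. T i \<omega> \<le> real t}. ennreal (\<phi> (age_cell m t (T i \<omega>))))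
      = (\<Prod>j<?R. ennreal (\<phi> (?R - Suc j)) ^ N j \<omega>)"
  proof eventually_elim
    case (elim \<omega>)
    then obtain n where n: "\<And>i. T i \<omega> \<le> real t \<longleftrightarrow> i < n" by auto
    have pos: "0 < T i \<omega>" for i
      using elim by (meson le_less_trans less_le_trans not_less strict_mono_less_eq zero_le)
    define A where "A j = {i. real j / real m < T i \<omega> \<and> T i \<omega> \<le> real (Suc j) / real m}" for j
    have le_t: "real (Suc j) / real m \<le> real t" if "j < ?R" for j
    proof -
      have "real (Suc j) \<le> real (m * t)" using that by (simp only: of_nat_le_iff Suc_le_eq)
      then show ?thesis using \<open>0 < m\<close> by (simp add: field_simps)
    qed
    \<comment> \<open>The cells partition the arrivals because all of them are positive.\<close>
    have un: "{i. T i \<omega> \<le> real t} = (\<Union>j<?R. A j)"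
    proof (intro equalityI subsetI)
      fix i assume i: "i \<in> {i. T i \<omega> \<le> real t}"
      define c where "c = \<lceil>real m * T i \<omega>\<rceil>"
      have mt: "0 < real m * T i \<omega>" using pos \<open>0 < m\<close> by simp
      then have c1: "1 \<le> c" unfolding c_def by linarith
      have "real m * T i \<omega> \<le> real m * real t" using i by (intro mult_left_mono) auto
      then have "c \<le> int ?R" unfolding c_def by (simp add: ceiling_le_iff)
      then have j: "nat (c - 1) < ?R" using c1 by linarith
      have "real_of_int c - 1 < real m * T i \<omega>" "real m * T i \<omega> \<le> real_of_int c"
        unfolding c_def by linarith+
      then have "i \<in> A (nat (c - 1))"
        using c1 \<open>0 < m\<close> by (simp add: A_def field_simps)
      then show "i \<in> (\<Union>j<?R. A j)" using j by auto
    next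
      fix i assume "i \<in> (\<Union>j<?R. A j)"
      then show "i \<in> {i. T i \<omega> \<le> real t}" using le_t by (force simp: A_def)
    qed
    have fin: "finite {i. T i \<omega> \<le> real t}" by (simp add: n)
    have disj: "A j \<inter> A j' = {}" if "j \<noteq> j'" for j j'
    proof -
      have "A j \<inter> A j' = {}" if "j < j'" for j j'
      proof -
        have "real (Suc j) / real m \<le> real j' / real m"
          using that by (intro divide_right_mono) auto
        then show ?thesis by (force simp: A_def)
      qed
      then show ?thesis using that by (metis inf_commute linorder_neqE_nat)
    qed
    have "(\<Prod>i\<in>{i. T i \<omega> \<le> real t}. ennreal (\<phi> (age_cell m t (T i \<omega>))))
        = (\<Prod>j<?R. \<Prod>i\<in>A j. ennreal (\<phi> (age_cell m t (T i \<omega>))))"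
      unfolding un
    proof (rule prod.UNION_disjoint)
      show "\<forall>j\<in>{..<?R}. finite (A j)"
        using fin unfolding un by (meson finite_subset UN_upper)
    qed (use disj in auto)
    also have "\<dots> = (\<Prod>j<?R. \<Prod>i\<in>A j. ennreal (\<phi> (?R - Suc j)))"
      using age_cell_eq[OF \<open>0 < m\<close>] by (intro prod.cong refl) (auto simp: A_def)
    finally show ?case by (simp add: N_def A_def)
  qed
  then have "(\<integral>\<^sup>+\<omega>. (\<Prod>i\<in>{i. T i \<omega> \<le> real t}. ennreal (\<phi> (age_cell m t (T i \<omega>)))) \<partial>M)
      = (\<integral>\<^sup>+\<omega>. (\<Prod>j<?R. ennreal (\<phi> (?R - Suc j)) ^ N j \<omega>) \<partial>M)"
    by (rule nn_integral_cong_AE)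
  also have "\<dots> = (\<Prod>j<?R. \<integral>\<^sup>+\<omega>. ennreal (\<phi> (?R - Suc j)) ^ N j \<omega> \<partial>M)"
  proof (rule indep_vars_nn_integral)
    from indep_N have "indep_vars (\<lambda>_. count_space UNIV) N {..<?R}"
      by (rule indep_vars_subset) auto
    then show "indep_vars (\<lambda>_. borel) (\<lambda>j \<omega>. ennreal (\<phi> (?R - Suc j)) ^ N j \<omega>) {..<?R}"
      by (rule indep_vars_compose2) auto
  qed auto
  also have "\<dots> = (\<Prod>j<?R. ennreal (exp (r / real m * (\<phi> (?R - Suc j) - 1))))"
  proof (rule prod.cong[OF refl])
    fix j
    have law: "distr M (count_space UNIV) (N j) = measure_pmf (poisson_pmf (r / real m))"
    proof -
      have "real (Suc j) / real m - real j / real m = 1 / real m" by (simp add: diff_divide_distrib[symmetric])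
      moreover have "0 \<le> real j / real m \<and> real j / real m < real (Suc j) / real m"
        using \<open>0 < m\<close> by (simp add: divide_strict_right_mono)
      ultimately show ?thesis
        using poisson_processD(3)[OF pp, of "real j / real m" "real (Suc j) / real m"]
        unfolding N_def[abs_def] by simp
    qed
    have "random_variable (count_space UNIV) (N j)"
      using indep_N by (auto simp: indep_vars_def)
    then have "(\<integral>\<^sup>+\<omega>. ennreal (\<phi> (?R - Suc j)) ^ N j \<omega> \<partial>M)
        = (\<integral>\<^sup>+n. ennreal (\<phi> (?R - Suc j)) ^ n \<partial>distr M (count_space UNIV) (N j))"
      by (subst nn_integral_distr) auto
    also have "\<dots> = ennreal (exp (r / real m * (\<phi> (?R - Suc j) - 1)))"
      unfolding law using assms by (intro nn_integral_power_poisson) auto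
    finally show "(\<integral>\<^sup>+\<omega>. ennreal (\<phi> (?R - Suc j)) ^ N j \<omega> \<partial>M)
        = ennreal (exp (r / real m * (\<phi> (?R - Suc j) - 1)))" .
  qed
  also have "\<dots> = ennreal (exp (r / real m * (\<Sum>j<?R. \<phi> (?R - Suc j) - 1)))"
    by (simp add: prod_ennreal exp_sum sum_distrib_left)
  also have "(\<Sum>j<?R. \<phi> (?R - Suc j) - 1) = (\<Sum>j<?R. \<phi> j - 1)"
    by (rule sum.nat_diff_reindex)
  finally show ?thesis .
qed

lemma (in prob_space) indep_vars_of_indep_sigma_algebras:
  assumes "indep_sets (\<lambda>j. sets (A j)) I"
    and "\<And>j. j \<in> I \<Longrightarrow> space (A j) = space M"
    and "\<And>j. j \<in> I \<Longrightarrow> X j \<in> A j \<rightarrow>\<^sub>M N j"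
  shows "indep_vars N X I"
  unfolding indep_vars_def2
proof (intro conjI ballI)
  fix j assume j: "j \<in> I"
  then have "sets (A j) \<subseteq> events"
    using assms(1) by (auto simp: indep_sets_def)
  then show "random_variable (N j) (X j)"
    using assms(2,3)[OF j] by (auto simp: measurable_def)
next
  show "indep_sets (\<lambda>i. {X i -` A \<inter> space M |A. A \<in> sets (N i)}) I"
  proof (rule indep_sets_mono_sets[OF assms(1)])
    fix j assume j: "j \<in> I"
    show "{X j -` B \<inter> space M |B. B \<in> sets (N j)} \<subseteq> sets (A j)"
      using measurable_sets[OF assms(3)[OF j]] assms(2)[OF j] by auto
  qed
qed

context stationary_loss_network
begin

definition source_algebra :: "source \<Rightarrow> 'a measure" where
  "source_algebra j = (case j of
     Initial \<Rightarrow> vimage_algebra (space M) (B 0) profile_algebra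
   | Arrivals k \<Rightarrow> vimage_algebra (space M) (\<lambda>\<omega> i. T k i \<omega>) (\<Pi>\<^sub>M i\<in>UNIV. borel)
   | Request k i \<Rightarrow> vimage_algebra (space M) (Z k i) (count_space UNIV))"

lemma indep_sources:
  assumes "J \<subseteq> {Arrivals k | k. k \<in> {1..K}} \<union> {Request k i | k i. k \<in> {1..K}}"
  shows "indep_sets (\<lambda>j. sets (source_algebra j)) J"
proof -
  have eq: "(\<lambda>j. sets (source_algebra j)) = (\<lambda>j. case j of
            Initial \<Rightarrow> sets (vimage_algebra (space M) (B 0) profile_algebra)
          | Arrivals k \<Rightarrow> sets (vimage_algebra (space M) (\<lambda>\<omega> i. T k i \<omega>) (\<Pi>\<^sub>M i\<in>UNIV. borel))
          | Request k i \<Rightarrow> sets (vimage_algebra (space M) (Z k i) (count_space UNIV)))"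
    by (auto simp: source_algebra_def split: source.splits)
  show ?thesis unfolding eq by (rule indep_sets_mono_index[OF _ independence]) (use assms in auto)
qed

lemma space_source_algebra[simp]: "space (source_algebra j) = space M"
  by (simp add: source_algebra_def split: source.splits)

lemma arrivals_source: "(\<lambda>\<omega> i. T k i \<omega>) \<in> source_algebra (Arrivals k) \<rightarrow>\<^sub>M (\<Pi>\<^sub>M i\<in>UNIV. borel)"
  unfolding source_algebra_def
  by (simp, rule measurable_vimage_algebra1) (auto simp: space_PiM)

lemma request_source: "Z k i \<in> source_algebra (Request k i) \<rightarrow>\<^sub>M count_space UNIV"
  unfolding source_algebra_def
  by (simp, rule measurable_vimage_algebra1) auto

lemma finite_requests: "k \<in> {1..K} \<Longrightarrow> finite (set_pmf (p k))"
  using request_range by (meson finite_SigmaI finite_atLeastAtMost finite_subset)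

lemma measurable_arrival:
  assumes "k \<in> {1..K}" shows "random_variable borel (T k i)"
  using poisson_processD(1)[OF arrivals[OF assms]] .

lemma AE_finite_arrivals: "AE \<omega> in M. \<forall>k\<in>{1..K}. finite {i. T k i \<omega> \<le> t}"
proof -
  have AE: "AE \<omega> in M. finite {i. T k i \<omega> \<le> t}" if k: "k \<in> {1..K}" for k
    using poisson_process_finite_front[OF arrivals[OF k], of t]
  proof eventually_elim
    case (elim \<omega>)
    then obtain n where "\<And>i. T k i \<omega> \<le> t \<longleftrightarrow> i < n" by blast
    then have "{i. T k i \<omega> \<le> t} = {..<n}" by blast
    then show ?case by simp
  qed
  show ?thesis
    by (rule AE_ball_countable[THEN iffD2]) (use AE in \<open>auto intro: countable_finite\<close>)
qed

lemma AE_request_in_support: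
  assumes k: "k \<in> {1..K}"
  shows "AE \<omega> in M. \<forall>i. Z k i \<omega> \<in> set_pmf (p k)"
proof (subst AE_all_countable, intro allI)
  fix i
  have "AE z in distr M (count_space UNIV) (Z k i). z \<in> set_pmf (p k)"
    unfolding request_law[OF k] by (rule AE_measure_pmf)
  then show "AE \<omega> in M. Z k i \<omega> \<in> set_pmf (p k)"
    using request_measurable[OF k] by (simp add: AE_distr_iff)
qed

text \<open>Independence of requests and arrival times, in the form in which it will be used: for a nonnegative
functional \<open>h\<close> of the arrival times alone, the first \<open>n\<close> requests may be replaced by their
probabilities.\<close>

lemma nn_integral_arrivals_requests:
  assumes k: "k \<in> {1..K}" and h[measurable]: "h \<in> borel_measurable (\<Pi>\<^sub>M i\<in>UNIV. borel)"
  shows "(\<integral>\<^sup>+\<omega>. h (\<lambda>i. T k i \<omega>) * (\<Prod>i<n. indicator {z i} (Z k i \<omega>)) \<partial>M)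
       = (\<integral>\<^sup>+\<omega>. h (\<lambda>i. T k i \<omega>) * (\<Prod>i<n. ennreal (pmf (p k) (z i))) \<partial>M)"
proof -
  define J where "J = insert (Arrivals k) (Request k ` {..<n})"
  define X :: "source \<Rightarrow> 'a \<Rightarrow> ennreal" where
    "X j \<omega> = (case j of Arrivals k \<Rightarrow> h (\<lambda>i. T k i \<omega>) | Request k i \<Rightarrow> indicator {z i} (Z k i \<omega>) | Initial \<Rightarrow> 0)" for j \<omega>
  have "indep_vars (\<lambda>_. borel) X J"
  proof (rule indep_vars_of_indep_sigma_algebras)
    show "indep_sets (\<lambda>j. sets (source_algebra j)) J"
      by (rule indep_sources) (use k in \<open>auto simp: J_def\<close>)
    have "X (Arrivals k) \<in> borel_measurable (source_algebra (Arrivals k))"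
      unfolding X_def using measurable_compose[OF arrivals_source h] by simp
    moreover have "X (Request k i) \<in> borel_measurable (source_algebra (Request k i))" for i
      unfolding X_def using measurable_compose[OF request_source, of "indicator {z i}" borel k i] by simp
    ultimately show "X j \<in> borel_measurable (source_algebra j)" if "j \<in> J" for j
      using that by (auto simp: J_def)
  qed simp
  then have "(\<integral>\<^sup>+\<omega>. (\<Prod>j\<in>J. X j \<omega>) \<partial>M) = (\<Prod>j\<in>J. \<integral>\<^sup>+\<omega>. X j \<omega> \<partial>M)"
    by (intro indep_vars_nn_integral) (auto simp: J_def)
  moreover have "(\<Prod>j\<in>J. f j) = f (Arrivals k) * (\<Prod>i<n. f (Request k i))" for f :: "source \<Rightarrow> ennreal"
  proof -
    have "Arrivals k \<notin> Request k ` {..<n}" "inj_on (Request k) {..<n}" by (auto simp: inj_on_def)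
    then show ?thesis unfolding J_def by (simp add: prod.reindex)
  qed
  moreover have "(\<integral>\<^sup>+\<omega>. X (Request k i) \<omega> \<partial>M) = ennreal (pmf (p k) (z i))" for i
  proof -
    have "X (Request k i) = (\<lambda>\<omega>. indicator {z i} (Z k i \<omega>))" by (simp add: X_def fun_eq_iff)
    then have "(\<integral>\<^sup>+\<omega>. X (Request k i) \<omega> \<partial>M) = (\<integral>\<^sup>+y. indicator {z i} y \<partial>distr M (count_space UNIV) (Z k i))"
      by (subst nn_integral_distr[OF request_measurable[OF k]]) auto
    also have "\<dots> = ennreal (pmf (p k) (z i))"
      unfolding request_law[OF k] by (simp add: emeasure_pmf_single)
    finally show ?thesis .
  qed
  ultimately have "(\<integral>\<^sup>+\<omega>. h (\<lambda>i. T k i \<omega>) * (\<Prod>i<n. indicator {z i} (Z k i \<omega>)) \<partial>M)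
     = (\<integral>\<^sup>+\<omega>. h (\<lambda>i. T k i \<omega>) \<partial>M) * (\<Prod>i<n. ennreal (pmf (p k) (z i)))"
    by (simp add: X_def)
  moreover have "(\<lambda>\<omega>. h (\<lambda>i. T k i \<omega>)) \<in> borel_measurable M"
    using measurable_arrival[OF k] by (intro measurable_compose[OF _ h] measurable_PiM_single') (auto simp: space_PiM)
  ultimately show ?thesis
    by (simp add: nn_integral_multc)
qed

text \<open>The product of \<open>g\<close> over all arrivals up to \<open>t\<close>, split according to the number \<open>n\<close> of these arrivals. At
most one summand is nonzero. Written as a series of products of fixed length it is measurable with
respect to the sources of class \<open>k\<close>, and integrals can be taken term by term.\<close>

definition arrival_product :: "real \<Rightarrow> (real \<Rightarrow> nat \<times> nat \<Rightarrow> ennreal) \<Rightarrow> nat \<Rightarrow> 'a \<Rightarrow> ennreal" where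
  "arrival_product t g k \<omega> = (\<Sum>n. of_bool (\<forall>i. T k i \<omega> \<le> t \<longleftrightarrow> i < n) * (\<Prod>i<n. g (T k i \<omega>) (Z k i \<omega>)))"

lemma arrival_product_eq:
  assumes "\<forall>i. T k i \<omega> \<le> t \<longleftrightarrow> i < n"
  shows "arrival_product t g k \<omega> = (\<Prod>i\<in>{i. T k i \<omega> \<le> t}. g (T k i \<omega>) (Z k i \<omega>))"
proof -
  have n: "(\<forall>i. T k i \<omega> \<le> t \<longleftrightarrow> i < n') \<longleftrightarrow> n' = n" for n'
    using assms by (metis linorder_neqE_nat less_irrefl)
  have "arrival_product t g k \<omega> = (\<Sum>n'\<in>{n}. of_bool (\<forall>i. T k i \<omega> \<le> t \<longleftrightarrow> i < n') * (\<Prod>i<n'. g (T k i \<omega>) (Z k i \<omega>)))"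
    unfolding arrival_product_def by (rule suminf_finite) (auto simp: n)
  also have "\<dots> = (\<Prod>i<n. g (T k i \<omega>) (Z k i \<omega>))" using assms by (simp add: n)
  also have "{..<n} = {i. T k i \<omega> \<le> t}" using assms by auto
  finally show ?thesis .
qed

lemma AE_arrival_product_eq:
  assumes k: "k \<in> {1..K}"
  shows "AE \<omega> in M. arrival_product t g k \<omega> = (\<Prod>i\<in>{i. T k i \<omega> \<le> t}. g (T k i \<omega>) (Z k i \<omega>))"
  using poisson_process_finite_front[OF arrivals[OF k], of t]
  by eventually_elim (metis arrival_product_eq)

text \<open>Given the arrival times, the requests are independent with law \<open>p k\<close>, so each factor of the product may be
replaced by its mean over the request. With the number of factors fixed, the product is expanded over all
tuples of requests, which is a finite sum since the laws have finite support.\<close>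

lemma nn_integral_arrival_product_mark_average:
  assumes k: "k \<in> {1..K}" and g[measurable]: "\<And>z. (\<lambda>\<tau>. g \<tau> z) \<in> borel_measurable borel"
  shows "(\<integral>\<^sup>+\<omega>. arrival_product t g k \<omega> \<partial>M)
       = (\<integral>\<^sup>+\<omega>. arrival_product t (\<lambda>\<tau> _. \<Sum>z\<in>set_pmf (p k). g \<tau> z * ennreal (pmf (p k) z)) k \<omega> \<partial>M)"
proof -
  note [measurable] = measurable_arrival[OF k] request_measurable[OF k]
  have meas: "(\<lambda>\<omega>. of_bool (\<forall>i. T k i \<omega> \<le> t \<longleftrightarrow> i < n) * (\<Prod>i<n. g' (T k i \<omega>) (Z k i \<omega>)) :: ennreal) \<in> borel_measurable M"
    if [measurable]: "\<And>z. (\<lambda>\<tau>. g' \<tau> z) \<in> borel_measurable borel" for n g'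
  proof -
    have [measurable]: "(\<lambda>\<omega>. g' (T k i \<omega>) (Z k i \<omega>)) \<in> borel_measurable M" for i
      by (rule measurable_compose_countable[where f = "\<lambda>z \<omega>. g' (T k i \<omega>) z"]) measurable
    show ?thesis by measurable
  qed
  let ?S = "set_pmf (p k)"
  have "(\<integral>\<^sup>+\<omega>. of_bool (\<forall>i. T k i \<omega> \<le> t \<longleftrightarrow> i < n) * (\<Prod>i<n. g (T k i \<omega>) (Z k i \<omega>)) \<partial>M)
     = (\<integral>\<^sup>+\<omega>. of_bool (\<forall>i. T k i \<omega> \<le> t \<longleftrightarrow> i < n) * (\<Prod>i<n. \<Sum>z\<in>?S. g (T k i \<omega>) z * ennreal (pmf (p k) z)) \<partial>M)" (is "?L = ?R") for n
  proof -
    let ?P = "Pi\<^sub>E {..<n} (\<lambda>_. ?S)"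
    have finP: "finite ?P" by (intro finite_PiE) (auto simp: finite_requests[OF k])
    define h where "h z x = of_bool (\<forall>i. x i \<le> t \<longleftrightarrow> i < n) * (\<Prod>i<n. g (x i) (z i))" for z :: "nat \<Rightarrow> nat \<times> nat" and x :: "nat \<Rightarrow> real"
    have h[measurable]: "h z \<in> borel_measurable (\<Pi>\<^sub>M i\<in>UNIV. borel)" for z
      unfolding h_def[abs_def] by measurable
    have hT: "(\<lambda>\<omega>. h z (\<lambda>i. T k i \<omega>)) \<in> borel_measurable M" for z
      by (intro measurable_compose[OF _ h] measurable_PiM_single') (auto simp: space_PiM)
    have hZ: "(\<lambda>\<omega>. indicator {z i} (Z k i \<omega>) :: ennreal) \<in> borel_measurable M" for z i
      by (rule measurable_compose[OF request_measurable[OF k]]) simp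
    have "?L = (\<integral>\<^sup>+\<omega>. (\<Sum>z\<in>?P. h z (\<lambda>i. T k i \<omega>) * (\<Prod>i<n. indicator {z i} (Z k i \<omega>))) \<partial>M)"
    proof (rule nn_integral_cong_AE)
      show "AE \<omega> in M. of_bool (\<forall>i. T k i \<omega> \<le> t \<longleftrightarrow> i < n) * (\<Prod>i<n. g (T k i \<omega>) (Z k i \<omega>))
         = (\<Sum>z\<in>?P. h z (\<lambda>i. T k i \<omega>) * (\<Prod>i<n. indicator {z i} (Z k i \<omega>)))"
        using AE_request_in_support[OF k]
      proof eventually_elim
        case (elim \<omega>)
        have "(\<Prod>i<n. g (T k i \<omega>) (Z k i \<omega>)) = (\<Prod>i<n. \<Sum>z\<in>?S. g (T k i \<omega>) z * indicator {z} (Z k i \<omega>))"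
        proof (rule prod.cong[OF refl])
          fix i
          have "(\<Sum>z\<in>?S. g (T k i \<omega>) z * indicator {z} (Z k i \<omega>)) = (\<Sum>z\<in>?S. if z = Z k i \<omega> then g (T k i \<omega>) z else 0)"
            by (intro sum.cong) (auto simp: indicator_def)
          then show "g (T k i \<omega>) (Z k i \<omega>) = (\<Sum>z\<in>?S. g (T k i \<omega>) z * indicator {z} (Z k i \<omega>))"
            using elim finite_requests[OF k] by simp
        qed
        also have "\<dots> = (\<Sum>z\<in>?P. \<Prod>i<n. g (T k i \<omega>) (z i) * indicator {z i} (Z k i \<omega>))"
          by (rule prod_sum_PiE) (auto simp: finite_requests[OF k])
        finally show ?case
          by (simp add: sum_distrib_left h_def prod.distrib mult.assoc)
      qed
    qed
    also have "\<dots> = (\<Sum>z\<in>?P. \<integral>\<^sup>+\<omega>. h z (\<lambda>i. T k i \<omega>) * (\<Prod>i<n. indicator {z i} (Z k i \<omega>)) \<partial>M)"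
      by (intro nn_integral_sum borel_measurable_times_ennreal borel_measurable_prod_ennreal hT hZ)
    also have "\<dots> = (\<Sum>z\<in>?P. \<integral>\<^sup>+\<omega>. h z (\<lambda>i. T k i \<omega>) * (\<Prod>i<n. ennreal (pmf (p k) (z i))) \<partial>M)"
      by (intro sum.cong refl nn_integral_arrivals_requests[OF k] h)
    also have "\<dots> = (\<integral>\<^sup>+\<omega>. (\<Sum>z\<in>?P. h z (\<lambda>i. T k i \<omega>) * (\<Prod>i<n. ennreal (pmf (p k) (z i)))) \<partial>M)"
      by (intro nn_integral_sum[symmetric] borel_measurable_times_ennreal borel_measurable_prod_ennreal hT borel_measurable_const)
    also have "\<dots> = ?R"
    proof (rule nn_integral_cong)
      fix \<omega>
      have "(\<Prod>i<n. \<Sum>z\<in>?S. g (T k i \<omega>) z * ennreal (pmf (p k) z))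
         = (\<Sum>z\<in>?P. \<Prod>i<n. g (T k i \<omega>) (z i) * ennreal (pmf (p k) (z i)))"
        by (rule prod_sum_PiE) (auto simp: finite_requests[OF k])
      then show "(\<Sum>z\<in>?P. h z (\<lambda>i. T k i \<omega>) * (\<Prod>i<n. ennreal (pmf (p k) (z i))))
         = of_bool (\<forall>i. T k i \<omega> \<le> t \<longleftrightarrow> i < n) * (\<Prod>i<n. \<Sum>z\<in>?S. g (T k i \<omega>) z * ennreal (pmf (p k) z))"
        by (simp add: sum_distrib_left h_def prod.distrib mult.assoc)
    qed
    finally show ?thesis .
  qed
  then show ?thesis
    unfolding arrival_product_def by (subst (1 2) nn_integral_suminf) (auto intro!: meas)
qed

lemma nn_integral_arrival_product:
  assumes k: "k \<in> {1..K}" and "0 < m" and w: "\<And>r z. 0 \<le> w r z"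
  shows "(\<integral>\<^sup>+\<omega>. arrival_product (real t) (\<lambda>\<tau> z. ennreal (w (age_cell m t \<tau>) z)) k \<omega> \<partial>M)
       = ennreal (exp (rate k / real m * (\<Sum>r<m * t. (\<Sum>z\<in>set_pmf (p k). w r z * pmf (p k) z) - 1)))"
proof -
  let ?\<phi> = "\<lambda>r. \<Sum>z\<in>set_pmf (p k). w r z * pmf (p k) z"
  have "(\<integral>\<^sup>+\<omega>. arrival_product (real t) (\<lambda>\<tau> z. ennreal (w (age_cell m t \<tau>) z)) k \<omega> \<partial>M)
      = (\<integral>\<^sup>+\<omega>. arrival_product (real t) (\<lambda>\<tau> _. ennreal (?\<phi> (age_cell m t \<tau>))) k \<omega> \<partial>M)"
    using w by (subst nn_integral_arrival_product_mark_average[OF k])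
      (auto simp: ennreal_mult[symmetric] sum_ennreal)
  also have "\<dots> = (\<integral>\<^sup>+\<omega>. (\<Prod>i\<in>{i. T k i \<omega> \<le> real t}. ennreal (?\<phi> (age_cell m t (T k i \<omega>)))) \<partial>M)"
    by (rule nn_integral_cong_AE[OF AE_arrival_product_eq[OF k]])
  also have "\<dots> = ennreal (exp (rate k / real m * (\<Sum>r<m * t. ?\<phi> r - 1)))"
    using w by (intro poisson_process_prod_step[OF arrivals[OF k] rate_pos[OF k] \<open>0 < m\<close>] sum_nonneg) auto
  finally show ?thesis .
qed

text \<open>Different classes are driven by disjoint groups of independent sources.\<close>

lemma indep_arrival_products:
  assumes g: "\<And>k z. (\<lambda>\<tau>. g k \<tau> z) \<in> borel_measurable borel"
  shows "indep_vars (\<lambda>_. borel) (\<lambda>k. arrival_product t (g k) k) {1..K}"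
proof -
  let ?I = "\<lambda>k. insert (Arrivals k) (range (Request k))"
  define A where "A k = sigma (space M) (\<Union>j\<in>?I k. sets (source_algebra j))" for k
  have sub: "(\<Union>j\<in>?I k. sets (source_algebra j)) \<subseteq> Pow (space M)" for k
    using sets.sets_into_space by fastforce
  have "indep_sets (\<lambda>k. sigma_sets (space M) (\<Union>j\<in>?I k. sets (source_algebra j))) {1..K}"
  proof (rule indep_sets_collect_sigma)
    show "indep_sets (\<lambda>j. sets (source_algebra j)) (\<Union>k\<in>{1..K}. ?I k)"
      by (rule indep_sources) auto
    show "Int_stable (sets (source_algebra j))" for j
      by (rule sets.Int_stable)
  qed (auto simp: disjoint_family_on_def)
  then have "indep_sets (\<lambda>k. sets (A k)) {1..K}"
    using sub by (simp add: A_def)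
  then show ?thesis
  proof (rule indep_vars_of_indep_sigma_algebras)
    show "space (A k) = space M" for k unfolding A_def using sub by simp
    fix k
    have lift: "f \<in> A k \<rightarrow>\<^sub>M N" if "f \<in> source_algebra j \<rightarrow>\<^sub>M N" "j \<in> ?I k" for f and N :: "'c measure" and j
    proof -
      have "sets (source_algebra j) \<subseteq> sets (A k)"
        using sub[of k] that(2) unfolding A_def by (auto intro: sigma_sets.Basic)
      moreover have "space (A k) = space M" unfolding A_def using sub by simp
      ultimately show ?thesis using that(1) by (auto simp: measurable_def)
    qed
    have [measurable]: "T k i \<in> borel_measurable (A k)" for i
      using measurable_compose[OF lift[OF arrivals_source] measurable_component_singleton[of i]] by simp
    have [measurable]: "Z k i \<in> A k \<rightarrow>\<^sub>M count_space UNIV" for i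
      using lift[OF request_source] by simp
    note [measurable] = g
    have [measurable]: "(\<lambda>\<omega>. g k (T k i \<omega>) (Z k i \<omega>)) \<in> borel_measurable (A k)" for i
      by (rule measurable_compose_countable[where f = "\<lambda>z \<omega>. g k (T k i \<omega>) z"]) measurable
    show "arrival_product t (g k) k \<in> borel_measurable (A k)"
      unfolding arrival_product_def[abs_def] by measurable
  qed
qed

text \<open>The generating functional of the marked Poisson process formed by the arrivals of all classes up to time
\<open>t\<close>, for weights that depend on the cell of the age and on the request. All probabilistic information
about the arrivals enters through this formula.\<close>

theorem generating_functional:
  assumes "0 < m" and w: "\<And>r z. 0 \<le> w r z"
  shows "(\<integral>\<^sup>+\<omega>. (\<Prod>k=1..K. \<Prod>i\<in>{i. T k i \<omega> \<le> real t}. ennreal (w (age_cell m t (T k i \<omega>)) (Z k i \<omega>))) \<partial>M)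
    = ennreal (exp (\<Sum>k=1..K. rate k / real m * (\<Sum>r<m * t. (\<Sum>z\<in>set_pmf (p k). w r z * pmf (p k) z) - 1)))"
proof -
  let ?g = "\<lambda>\<tau> z. ennreal (w (age_cell m t \<tau>) z)"
  have "AE \<omega> in M. \<forall>k\<in>{1..K}. arrival_product (real t) ?g k \<omega> = (\<Prod>i\<in>{i. T k i \<omega> \<le> real t}. ?g (T k i \<omega>) (Z k i \<omega>))"
    by (subst AE_ball_countable) (auto intro!: AE_arrival_product_eq)
  then have "(\<integral>\<^sup>+\<omega>. (\<Prod>k=1..K. \<Prod>i\<in>{i. T k i \<omega> \<le> real t}. ?g (T k i \<omega>) (Z k i \<omega>)) \<partial>M)
     = (\<integral>\<^sup>+\<omega>. (\<Prod>k=1..K. arrival_product (real t) ?g k \<omega>) \<partial>M)"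
    by (intro nn_integral_cong_AE) (auto elim!: eventually_mono intro!: prod.cong)
  also have "\<dots> = (\<Prod>k=1..K. \<integral>\<^sup>+\<omega>. arrival_product (real t) ?g k \<omega> \<partial>M)"
    by (intro indep_vars_nn_integral indep_arrival_products[where g = "\<lambda>_. ?g"]) auto
  also have "\<dots> = (\<Prod>k=1..K. ennreal (exp (rate k / real m * (\<Sum>r<m * t. (\<Sum>z\<in>set_pmf (p k). w r z * pmf (p k) z) - 1))))"
    by (intro prod.cong refl nn_integral_arrival_product assms) auto
  finally show ?thesis by (simp add: prod_ennreal exp_sum)
qed

end

section \<open>Reservations on a time grid\<close>

text \<open>Whether a request \<open>(d, s)\<close> whose age lies in cell \<open>r\<close> can occupy its unit at some moment between \<open>a + j/m\<close> and
\<open>a + (j + 1)/m\<close> ahead. The term \<open>1\<close> compensates the widths of the two cells, so no covering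
reservation is missed. Everything is multiplied by \<open>m\<close> and written without subtraction on the natural numbers.\<close>

definition covers :: "nat \<Rightarrow> nat \<Rightarrow> nat \<Rightarrow> nat \<Rightarrow> nat \<times> nat \<Rightarrow> bool" where
  "covers m a j r z \<longleftrightarrow> (case z of (d, s) \<Rightarrow> m * d \<le> r + j + 1 + m * a \<and> r + j + m * a \<le> m * (d + s))"

text \<open>A reservation that covers the moment \<open>x\<close> ahead is counted in the grid cell of \<open>x\<close>. This pathwise
inclusion is what replaces the supremum over a continuum of moments by a maximum over cells.\<close>

lemma coversI:
  fixes x :: real
  assumes "0 < m" and "\<tau> \<le> real t" "real a \<le> x"
    and cov: "\<tau> + real d \<le> real t + x" "real t + x \<le> \<tau> + real d + real s"
  shows "covers m a (nat \<lfloor>real m * (x - real a)\<rfloor>) (age_cell m t \<tau>) (d, s)"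
proof -
  define r where "r = age_cell m t \<tau>"
  define j where "j = nat \<lfloor>real m * (x - real a)\<rfloor>"
  have "0 \<le> real m * (real t - \<tau>)" "0 \<le> real m * (x - real a)" using assms by simp_all
  then have r: "real r \<le> real m * (real t - \<tau>)" "real m * (real t - \<tau>) < real r + 1"
    and j: "real j \<le> real m * (x - real a)" "real m * (x - real a) < real j + 1"
    unfolding r_def j_def age_cell_def by linarith+
  have "real m * real d \<le> real m * (real t - \<tau> + x)" "real m * (real t - \<tau> + x) \<le> real m * (real d + real s)"
    using cov by (auto intro!: mult_left_mono)
  then have "real (m * d) < real (r + j + 2 + m * a)" "real (r + j + m * a) \<le> real (m * (d + s))"
    using r j by (simp_all add: algebra_simps)
  then have "m * d < r + j + 2 + m * a" "r + j + m * a \<le> m * (d + s)"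
    by (simp_all only: of_nat_less_iff of_nat_le_iff)
  then show ?thesis unfolding r_def[symmetric] j_def[symmetric] covers_def by simp
qed

context
  fixes m a d s R :: nat
  assumes a_le_d: "a \<le> d" and R: "m * (d + s) < R"
begin

text \<open>Looking further ahead loses ages: adding \<open>j\<close> to the age turns a request that covers cell \<open>j\<close> into one that
covers cell \<open>0\<close>.\<close>

lemma card_covers_le_card_covers_0:
  "card {r. r < R \<and> covers m a j r (d, s)} \<le> card {r. r < R \<and> covers m a 0 r (d, s)}"
proof (rule card_inj_on_le)
  show "inj_on (\<lambda>r. r + j) {r. r < R \<and> covers m a j r (d, s)}" by (simp add: inj_on_def)
  show "(\<lambda>r. r + j) ` {r. r < R \<and> covers m a j r (d, s)} \<subseteq> {r. r < R \<and> covers m a 0 r (d, s)}"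
    using R by (auto simp: covers_def)
qed simp

lemma card_covers_0_le: "card {r. r < R \<and> covers m a 0 r (d, s)} \<le> m * s + 2"
proof -
  have "{r. r < R \<and> covers m a 0 r (d, s)} \<subseteq> {m * (d - a) - 1..m * (d - a) + m * s}"
    using a_le_d by (auto simp: covers_def diff_mult_distrib2 add_mult_distrib2)
  then have "card {r. r < R \<and> covers m a 0 r (d, s)} \<le> card {m * (d - a) - 1..m * (d - a) + m * s}"
    by (intro card_mono) auto
  also have "\<dots> \<le> m * s + 2" by simp
  finally show ?thesis .
qed

lemma le_card_covers_0: "m * s \<le> card {r. r < R \<and> covers m a 0 r (d, s)}"
proof -
  obtain e where e: "d = a + e" using a_le_d le_Suc_ex by blast
  have "{m * (d - a)..m * (d - a) + m * s} \<subseteq> {r. r < R \<and> covers m a 0 r (d, s)}"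
  proof
    fix r assume "r \<in> {m * (d - a)..m * (d - a) + m * s}"
    then have "m * e \<le> r" "r \<le> m * e + m * s" by (simp_all add: e)
    moreover have "m * a + m * e + m * s < R" using R by (simp add: e add_mult_distrib2)
    ultimately show "r \<in> {r. r < R \<and> covers m a 0 r (d, s)}"
      by (simp add: covers_def e add_mult_distrib2)
  qed
  then have "card {m * (d - a)..m * (d - a) + m * s} \<le> card {r. r < R \<and> covers m a 0 r (d, s)}"
    by (intro card_mono) auto
  then show ?thesis by simp
qed

lemma card_covers_0_diff_le:
  "card ({r. r < R \<and> covers m a 0 r (d, s)} - {r. r < R \<and> covers m a j r (d, s)}) \<le> j"
proof -
  have "{r. r < R \<and> covers m a 0 r (d, s)} - {r. r < R \<and> covers m a j r (d, s)}
      \<subseteq> {m * (d + s) - m * a + 1 - j..<m * (d + s) - m * a + 1}"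
    using R by (auto simp: covers_def)
  then have "card ({r. r < R \<and> covers m a 0 r (d, s)} - {r. r < R \<and> covers m a j r (d, s)})
      \<le> card {m * (d + s) - m * a + 1 - j..<m * (d + s) - m * a + 1}"
    by (intro card_mono) auto
  also have "\<dots> \<le> j" by simp
  finally show ?thesis .
qed

lemma card_covers_diff_le:
  "card ({r. r < R \<and> covers m a j r (d, s)} - {r. r < R \<and> covers m a 0 r (d, s)})
   \<le> card ({r. r < R \<and> covers m a 0 r (d, s)} - {r. r < R \<and> covers m a j r (d, s)})"
  (is "card (?J - ?O) \<le> card (?O - ?J)")
proof -
  have "card ?J = card (?J \<inter> ?O) + card (?J - ?O)" "card ?O = card (?O \<inter> ?J) + card (?O - ?J)"
    by (simp_all add: card_Int_Diff)
  then show ?thesis using card_covers_le_card_covers_0[of j] by (simp add: Int_commute)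
qed

text \<open>A customer with the smallest reservation time \<open>a\<close> who covers a moment beyond \<open>a\<close> also covers the moment \<open>a\<close>, so such
customers contribute pure losses. They are the source of the negative drift.\<close>

lemma card_covers_loss:
  assumes "a = d" "0 < s"
  shows "{r. r < R \<and> covers m a j r (d, s)} \<subseteq> {r. r < R \<and> covers m a 0 r (d, s)}"
    and "min j m \<le> card ({r. r < R \<and> covers m a 0 r (d, s)} - {r. r < R \<and> covers m a j r (d, s)})"
proof -
  have ms: "m \<le> m * s" using assms(2) by simp
  show "{r. r < R \<and> covers m a j r (d, s)} \<subseteq> {r. r < R \<and> covers m a 0 r (d, s)}"
    using assms by (auto simp: covers_def)
  \<comment> \<open>The largest ages at which cell \<open>0\<close> is covered; those larger than \<open>m * s - j\<close> no longer cover cell \<open>j\<close>.\<close>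
  have "{m * s - (min j m - 1)..m * s} \<subseteq> {r. r < R \<and> covers m a 0 r (d, s)} - {r. r < R \<and> covers m a j r (d, s)}" if "0 < j" "0 < m"
    using R assms ms that by (auto simp: covers_def add_mult_distrib2)
  then have "card {m * s - (min j m - 1)..m * s} \<le> card ({r. r < R \<and> covers m a 0 r (d, s)} - {r. r < R \<and> covers m a j r (d, s)})" if "0 < j" "0 < m"
    using that by (intro card_mono) auto
  moreover have "min j m \<le> card {m * s - (min j m - 1)..m * s}" if "0 < j" "0 < m"
  proof -
    have "min j m \<le> m * s" "0 < min j m" using ms that by (auto intro: min.coboundedI2)
    then show ?thesis unfolding card_atLeastAtMost by linarith
  qed
  ultimately show "min j m \<le> card ({r. r < R \<and> covers m a 0 r (d, s)} - {r. r < R \<and> covers m a j r (d, s)})"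
    by (cases "0 < j \<and> 0 < m") (auto intro: order_trans)
qed

end

section \<open>Tail bounds for the reservation counts\<close>

text \<open>For negative \<open>x\<close> the bound follows from \<open>exp x \<le> 1 / (1 - x)\<close>.\<close>

lemma exp_minus_one_le_quadratic: "\<bar>x\<bar> \<le> 1 \<Longrightarrow> exp x - 1 \<le> x + x\<^sup>2" for x :: real
proof (cases "0 \<le> x")
  case True
  assume "\<bar>x\<bar> \<le> 1" then show ?thesis using exp_bound[of x] True by simp
next
  case False
  assume x: "\<bar>x\<bar> \<le> 1"
  have "1 - x \<le> exp (- x)" using exp_ge_add_one_self[of "- x"] by simp
  then have "exp x \<le> 1 / (1 - x)" using False by (simp add: exp_minus field_simps)
  also have "\<dots> \<le> 1 + x + x\<^sup>2"
  proof -
    have "x ^ 3 \<le> 0" using False mult_nonneg_nonpos[of "x * x" x] by (simp add: power3_eq_cube)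
    then have "1 \<le> (1 + x + x\<^sup>2) * (1 - x)" by (simp add: algebra_simps power2_eq_square power3_eq_cube)
    then show ?thesis using False by (simp add: divide_le_eq)
  qed
  finally show ?thesis by simp
qed

text \<open>The exponent of the moment generating function of a difference of two counts: linear in the difference
of the exclusive parts, quadratic in their sum. The first is the drift, the second the variance.\<close>

lemma sum_exp_indicator_diff_le:
  fixes \<theta> :: real
  assumes "finite A" "0 \<le> \<theta>" "\<theta> \<le> 1"
  shows "(\<Sum>r\<in>A. exp (\<theta> * (of_bool (P r) - of_bool (Q r))) - 1)
      \<le> \<theta> * (real (card ({r\<in>A. P r} - {r\<in>A. Q r})) - real (card ({r\<in>A. Q r} - {r\<in>A. P r})))
        + \<theta>\<^sup>2 * (real (card ({r\<in>A. P r} - {r\<in>A. Q r})) + real (card ({r\<in>A. Q r} - {r\<in>A. P r})))"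
proof -
  have card_eq: "real (card ({r\<in>A. P r} - {r\<in>A. Q r})) = (\<Sum>r\<in>A. of_bool (P r \<and> \<not> Q r))" for P Q
  proof -
    have "{r\<in>A. P r} - {r\<in>A. Q r} = {r\<in>A. P r \<and> \<not> Q r}" by auto
    then show ?thesis using assms(1) by (simp add: of_bool_def sum.If_cases Int_def)
  qed
  have "exp (\<theta> * (of_bool (P r) - of_bool (Q r))) - 1 \<le>
      \<theta> * (of_bool (P r \<and> \<not> Q r) - of_bool (Q r \<and> \<not> P r)) + \<theta>\<^sup>2 * (of_bool (P r \<and> \<not> Q r) + of_bool (Q r \<and> \<not> P r))" for r
    using exp_minus_one_le_quadratic[of \<theta>] exp_minus_one_le_quadratic[of "- \<theta>"] assms(2,3)
    by (cases "P r"; cases "Q r") auto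
  then have "(\<Sum>r\<in>A. exp (\<theta> * (of_bool (P r) - of_bool (Q r))) - 1) \<le>
      (\<Sum>r\<in>A. \<theta> * (of_bool (P r \<and> \<not> Q r) - of_bool (Q r \<and> \<not> P r)) + \<theta>\<^sup>2 * (of_bool (P r \<and> \<not> Q r) + of_bool (Q r \<and> \<not> P r)))"
    by (intro sum_mono)
  also have "\<dots> = \<theta> * ((\<Sum>r\<in>A. of_bool (P r \<and> \<not> Q r)) - (\<Sum>r\<in>A. of_bool (Q r \<and> \<not> P r)))
      + \<theta>\<^sup>2 * ((\<Sum>r\<in>A. of_bool (P r \<and> \<not> Q r)) + (\<Sum>r\<in>A. of_bool (Q r \<and> \<not> P r)))"
    by (simp only: sum.distrib sum_subtractf sum_distrib_left[symmetric])
  finally show ?thesis unfolding card_eq .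
qed

lemma (in prob_space) chernoff_bound:
  fixes X :: "'a \<Rightarrow> real"
  assumes X[measurable]: "random_variable borel X" and "0 \<le> \<theta>" "0 \<le> b"
    and E: "(\<integral>\<^sup>+\<omega>. ennreal (exp (\<theta> * X \<omega>)) \<partial>M) \<le> ennreal b"
  shows "prob {\<omega>\<in>space M. y \<le> X \<omega>} \<le> b * exp (- \<theta> * y)"
proof -
  have "emeasure M {\<omega>\<in>space M. y \<le> X \<omega>} = (\<integral>\<^sup>+\<omega>. indicator {\<omega>\<in>space M. y \<le> X \<omega>} \<omega> \<partial>M)"
    by simp
  also have "\<dots> \<le> (\<integral>\<^sup>+\<omega>. ennreal (exp (\<theta> * X \<omega>)) * ennreal (exp (- \<theta> * y)) \<partial>M)"
  proof (rule nn_integral_mono)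
    fix \<omega>
    have "1 \<le> ennreal (exp (\<theta> * X \<omega>)) * ennreal (exp (- \<theta> * y))" if "y \<le> X \<omega>"
    proof -
      have "\<theta> * y \<le> \<theta> * X \<omega>" using that assms(2) by (rule mult_left_mono)
      then have "1 \<le> exp (\<theta> * X \<omega> + - \<theta> * y)" by simp
      then have "ennreal 1 \<le> ennreal (exp (\<theta> * X \<omega>) * exp (- \<theta> * y))"
        by (intro ennreal_leI) (simp only: exp_add)
      then show ?thesis by (simp add: ennreal_mult)
    qed
    then show "indicator {\<omega>\<in>space M. y \<le> X \<omega>} \<omega> \<le> ennreal (exp (\<theta> * X \<omega>)) * ennreal (exp (- \<theta> * y))"
      by (auto simp: indicator_def)
  qed
  also have "\<dots> = (\<integral>\<^sup>+\<omega>. ennreal (exp (\<theta> * X \<omega>)) \<partial>M) * ennreal (exp (- \<theta> * y))"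
    by (rule nn_integral_multc) measurable
  also have "\<dots> \<le> ennreal b * ennreal (exp (- \<theta> * y))"
    using E by (rule mult_right_mono) simp
  finally show ?thesis
    using assms(3) by (simp add: emeasure_eq_measure ennreal_mult[symmetric] del: ennreal_le_iff add: ennreal_le_iff[OF mult_nonneg_nonneg])
qed

context stationary_loss_network
begin

definition point_count :: "nat \<Rightarrow> nat \<Rightarrow> (nat \<Rightarrow> nat \<times> nat \<Rightarrow> bool) \<Rightarrow> 'a \<Rightarrow> nat" where
  "point_count m t S \<omega> = (\<Sum>k=1..K. card {i. T k i \<omega> \<le> real t \<and> S (age_cell m t (T k i \<omega>)) (Z k i \<omega>)})"

lemma measurable_point_count[measurable]: "random_variable (count_space UNIV) (point_count m t S)"
proof -
  have "random_variable (count_space UNIV) (\<lambda>\<omega>. card {i. T k i \<omega> \<le> real t \<and> S (age_cell m t (T k i \<omega>)) (Z k i \<omega>)})"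
    if k: "k \<in> {1..K}" for k
  proof -
    note [measurable] = measurable_arrival[OF k] request_measurable[OF k]
    have [measurable]: "(\<lambda>\<omega>. S (age_cell m t (T k i \<omega>)) (Z k i \<omega>)) \<in> M \<rightarrow>\<^sub>M count_space UNIV" for i
      by (rule measurable_compose_countable[where f = "\<lambda>z \<omega>. S (age_cell m t (T k i \<omega>)) z"]) measurable
    show ?thesis by measurable
  qed
  then show ?thesis unfolding point_count_def[abs_def] by (intro measurable_sum_nat) auto
qed

lemma sum_pmf_requests: "k \<in> {1..K} \<Longrightarrow> (\<Sum>z\<in>set_pmf (p k). pmf (p k) z) = 1"
  using sum_pmf_eq_1[OF finite_requests, of k] by simp

text \<open>The joint moment generating function of two reservation counts that may overlap; for \<open>\<beta> = 0\<close> it is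
that of a Poisson variable.\<close>

lemma nn_integral_exp_point_counts:
  assumes "0 < m"
  shows "(\<integral>\<^sup>+\<omega>. ennreal (exp (\<alpha> * real (point_count m t S \<omega>) + \<beta> * real (point_count m t S' \<omega>))) \<partial>M)
    = ennreal (exp (\<Sum>k=1..K. rate k / real m * (\<Sum>z\<in>set_pmf (p k). pmf (p k) z *
        (\<Sum>r<m * t. exp (\<alpha> * of_bool (S r z) + \<beta> * of_bool (S' r z)) - 1))))"
proof -
  let ?w = "\<lambda>r z. exp (\<alpha> * of_bool (S r z) + \<beta> * of_bool (S' r z))"
  have "(\<integral>\<^sup>+\<omega>. ennreal (exp (\<alpha> * real (point_count m t S \<omega>) + \<beta> * real (point_count m t S' \<omega>))) \<partial>M)
     = (\<integral>\<^sup>+\<omega>. (\<Prod>k=1..K. \<Prod>i\<in>{i. T k i \<omega> \<le> real t}. ennreal (?w (age_cell m t (T k i \<omega>)) (Z k i \<omega>))) \<partial>M)"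
    using AE_finite_arrivals[of "real t"]
  proof (intro nn_integral_cong_AE, eventually_elim)
    case (elim \<omega>)
    then have fin: "finite {i. T k i \<omega> \<le> real t}" if "k \<in> {1..K}" for k using that by blast
    have card_eq: "real (card {i. T k i \<omega> \<le> real t \<and> P i}) = (\<Sum>i\<in>{i. T k i \<omega> \<le> real t}. of_bool (P i))"
      if "k \<in> {1..K}" for k P
      using fin[OF that] by (simp add: of_bool_def sum.If_cases Int_def)
    have "\<alpha> * real (point_count m t S \<omega>) + \<beta> * real (point_count m t S' \<omega>)
        = (\<Sum>k=1..K. \<Sum>i\<in>{i. T k i \<omega> \<le> real t}. \<alpha> * of_bool (S (age_cell m t (T k i \<omega>)) (Z k i \<omega>))
            + \<beta> * of_bool (S' (age_cell m t (T k i \<omega>)) (Z k i \<omega>)))"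
      unfolding point_count_def of_nat_sum sum_distrib_left sum.distrib
      by (intro arg_cong2[of _ _ _ _ "(+)"] sum.cong refl) (simp_all add: card_eq sum_distrib_left)
    then show ?case
      by (simp add: exp_sum prod_ennreal prod_nonneg)
        (intro arg_cong[of _ _ ennreal] prod.cong refl exp_sum fin, simp)
  qed
  also have "\<dots> = ennreal (exp (\<Sum>k=1..K. rate k / real m * (\<Sum>r<m * t. (\<Sum>z\<in>set_pmf (p k). ?w r z * pmf (p k) z) - 1)))"
    using assms by (rule generating_functional) simp
  also have "(\<Sum>k=1..K. rate k / real m * (\<Sum>r<m * t. (\<Sum>z\<in>set_pmf (p k). ?w r z * pmf (p k) z) - 1))
     = (\<Sum>k=1..K. rate k / real m * (\<Sum>z\<in>set_pmf (p k). pmf (p k) z * (\<Sum>r<m * t. ?w r z - 1)))"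
  proof (intro sum.cong refl arg_cong2[of _ _ _ _ "(*)"])
    fix k assume k: "k \<in> {1..K}"
    have "(\<Sum>r<m * t. (\<Sum>z\<in>set_pmf (p k). ?w r z * pmf (p k) z) - 1)
        = (\<Sum>r<m * t. \<Sum>z\<in>set_pmf (p k). pmf (p k) z * (?w r z - 1))"
      by (intro sum.cong refl) (simp add: right_diff_distrib sum_subtractf sum_pmf_requests[OF k] mult.commute)
    also have "\<dots> = (\<Sum>z\<in>set_pmf (p k). \<Sum>r<m * t. pmf (p k) z * (?w r z - 1))"
      by (rule sum.swap)
    finally show "(\<Sum>r<m * t. (\<Sum>z\<in>set_pmf (p k). ?w r z * pmf (p k) z) - 1)
        = (\<Sum>z\<in>set_pmf (p k). pmf (p k) z * (\<Sum>r<m * t. ?w r z - 1))"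
      by (simp add: sum_distrib_left)
  qed
  finally show ?thesis .
qed

definition mean_count :: "nat \<Rightarrow> nat \<Rightarrow> (nat \<Rightarrow> nat \<times> nat \<Rightarrow> bool) \<Rightarrow> real" where
  "mean_count m t S = (\<Sum>k=1..K. rate k / real m * (\<Sum>z\<in>set_pmf (p k). pmf (p k) z * real (card {r. r < m * t \<and> S r z})))"

lemma nn_integral_exp_point_count:
  assumes "0 < m"
  shows "(\<integral>\<^sup>+\<omega>. ennreal (exp (\<alpha> * real (point_count m t S \<omega>))) \<partial>M)
    = ennreal (exp (mean_count m t S * (exp \<alpha> - 1)))"
proof -
  have inner: "(\<Sum>r<m * t. exp (\<alpha> * of_bool (S r z) + 0 * of_bool (S r z)) - 1) = real (card {r. r < m * t \<and> S r z}) * (exp \<alpha> - 1)" for z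
  proof -
    have "(\<Sum>r<m * t. exp (\<alpha> * of_bool (S r z) + 0 * of_bool (S r z)) - 1) = (\<Sum>r<m * t. if S r z then exp \<alpha> - 1 else 0)"
      by (intro sum.cong) auto
    also have "\<dots> = real (card {r. r < m * t \<and> S r z}) * (exp \<alpha> - 1)"
      by (simp add: sum.If_cases Int_def)
    finally show ?thesis .
  qed
  show ?thesis
    using nn_integral_exp_point_counts[OF assms, of \<alpha> t S 0 S]
    unfolding inner mean_count_def
    by (simp add: sum_distrib_right sum_distrib_left mult.assoc)
qed

lemma point_count_poisson:
  assumes "0 < m" "0 < mean_count m t S"
  shows "distr M (count_space UNIV) (point_count m t S) = measure_pmf (poisson_pmf (mean_count m t S))"
proof (rule poisson_of_generating_function[OF measurable_point_count assms(2)])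
  fix z :: real assume z: "0 < z" "z < 1"
  have "ennreal z ^ n = ennreal (exp (ln z * real n))" for n
    using z by (simp add: exp_of_nat2_mult ennreal_power)
  then show "(\<integral>\<^sup>+\<omega>. ennreal z ^ point_count m t S \<omega> \<partial>M) = ennreal (exp (mean_count m t S * (z - 1)))"
    using nn_integral_exp_point_count[OF assms(1), of "ln z" t S] z by simp
qed

end

section \<open>Blocking probabilities at finite capacity\<close>

text \<open>The smallest reservation time and the horizon beyond which nothing is booked. The lower bound \<open>a\<close> is
attained by some class in the results where the drift matters.\<close>

locale bounded_requests = stationary_loss_network +
  fixes a W :: nat
  assumes reservation_ge: "\<And>k d s. k \<in> {1..K} \<Longrightarrow> (d, s) \<in> set_pmf (p k) \<Longrightarrow> a \<le> d"
    and horizon: "\<And>k d s. k \<in> {1..K} \<Longrightarrow> (d, s) \<in> set_pmf (p k) \<Longrightarrow> d + s \<le> W"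
begin

lemma service_pos: "k \<in> {1..K} \<Longrightarrow> (d, s) \<in> set_pmf (p k) \<Longrightarrow> 0 < s"
  using request_range by fastforce

text \<open>The comparison with unlimited capacity. By stationarity the profile may be observed at time \<open>W + 1\<close>, when all
reservations made before time \<open>0\<close> have ended. What remains are admitted customers who arrived
since, and they are among the arrivals that would cover the moment in question if nobody were rejected.\<close>

lemma blocking_prob_le_union:
  assumes m: "0 < m" and k: "k \<in> {1..K}" and ds: "(d, s) \<in> set_pmf (p k)"
  shows "blocking_prob \<pi> C d s
    \<le> prob {\<omega>\<in>space M. \<exists>j\<le>m * W. C \<le> point_count m (W + 1) (covers m a j) \<omega>}"
proof -
  let ?t = "W + 1"
  have "blocking_prob \<pi> C d s = measure (distr M profile_algebra (B (real ?t))) {f. \<not> admits C f d s}"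
    unfolding blocking_prob_def by (subst stationary) auto
  also have "\<dots> = prob (B (real ?t) -` {f. \<not> admits C f d s} \<inter> space M)"
    by (rule measure_distr[OF profile_measurable blocking_event_measurable]) simp
  also have "\<dots> \<le> prob {\<omega>\<in>space M. \<exists>j\<le>m * W. C \<le> point_count m ?t (covers m a j) \<omega>}"
  proof (rule finite_measure_mono_AE)
    from initial_profile dynamics AE_space AE_finite_arrivals[of "real ?t"]
    show "AE \<omega> in M. \<omega> \<in> B (real ?t) -` {f. \<not> admits C f d s} \<inter> space M
        \<longrightarrow> \<omega> \<in> {\<omega>\<in>space M. \<exists>j\<le>m * W. C \<le> point_count m ?t (covers m a j) \<omega>}"
    proof eventually_elim
      case (elim \<omega>)
      show ?case
      proof
        assume "\<omega> \<in> B (real ?t) -` {f. \<not> admits C f d s} \<inter> space M"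
        then obtain x where x: "real d \<le> x" "x \<le> real d + real s" and Cx: "C \<le> B (real ?t) \<omega> x"
          by (auto simp: admits_def not_less)
        have x0: "0 \<le> x" using x(1) by simp
        have ax: "real a \<le> x" using x(1) reservation_ge[OF k ds] by simp
        define j where "j = nat \<lfloor>real m * (x - real a)\<rfloor>"
        have "real m * (x - real a) \<le> real m * real W"
          using x(2) horizon[OF k ds] by (intro mult_left_mono) auto
        then have "\<lfloor>real m * (x - real a)\<rfloor> \<le> int (m * W)" by (simp add: floor_le_iff)
        then have jW: "j \<le> m * W" unfolding j_def nat_le_iff .
        \<comment> \<open>Reservations made before time \<open>0\<close> have age \<open>> W + 1\<close> and have ended.\<close>
        have "B 0 \<omega> (real ?t + x) = 0"
        proof -
          obtain bs :: "(real \<times> nat \<times> nat) list" where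
            bs: "\<forall>(\<tau>, d, s)\<in>set bs. 0 < \<tau> \<and> (\<exists>k\<in>{1..K}. (d, s) \<in> set_pmf (p k))"
            and B0: "\<forall>x\<ge>0. B 0 \<omega> x = length (filter (\<lambda>(\<tau>, d, s). real d - \<tau> \<le> x \<and> x \<le> real d + real s - \<tau>) bs)"
            using elim(1) unfolding booking_profiles_def by auto
          have "filter (\<lambda>(\<tau>, d, s). real d - \<tau> \<le> real ?t + x \<and> real ?t + x \<le> real d + real s - \<tau>) bs = []"
          proof (rule filter_False, safe)
            fix \<tau> d' s' assume "(\<tau>, d', s') \<in> set bs" and le: "real ?t + x \<le> real d' + real s' - \<tau>"
            then obtain k' where "0 < \<tau>" "k' \<in> {1..K}" "(d', s') \<in> set_pmf (p k')" using bs by auto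
            then have "0 < \<tau>" "d' + s' \<le> W" using horizon by auto
            then have "0 < \<tau>" "real d' + real s' \<le> real W" by linarith+
            then show False using le x0 by simp
          qed
          moreover have "0 \<le> real ?t + x" using x0 by simp
          ultimately show ?thesis using B0 by simp
        qed
        moreover have "B (real ?t) \<omega> x = B 0 \<omega> (real ?t + x) +
           card {(k, i). k \<in> {1..K} \<and> T k i \<omega> < real ?t \<and>
             (case Z k i \<omega> of (d, s) \<Rightarrow>
                admits C (B (T k i \<omega>) \<omega>) d s \<and>
                T k i \<omega> + real d \<le> real ?t + x \<and> real ?t + x \<le> T k i \<omega> + real d + real s)}"
          using elim(2) x0 of_nat_0_le_iff by blast
        ultimately have "C \<le> card {(k, i). k \<in> {1..K} \<and> T k i \<omega> < real ?t \<and>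
             (case Z k i \<omega> of (d, s) \<Rightarrow>
                admits C (B (T k i \<omega>) \<omega>) d s \<and>
                T k i \<omega> + real d \<le> real ?t + x \<and> real ?t + x \<le> T k i \<omega> + real d + real s)}" (is "_ \<le> card ?A")
          using Cx by simp
        also have "\<dots> \<le> card (SIGMA k:{1..K}. {i. T k i \<omega> \<le> real ?t \<and> covers m a j (age_cell m ?t (T k i \<omega>)) (Z k i \<omega>)})"
        proof (rule card_mono)
          show "finite (SIGMA k:{1..K}. {i. T k i \<omega> \<le> real ?t \<and> covers m a j (age_cell m ?t (T k i \<omega>)) (Z k i \<omega>)})"
            using elim(4) by (intro finite_SigmaI) (auto intro: rev_finite_subset)
          show "?A \<subseteq> (SIGMA k:{1..K}. {i. T k i \<omega> \<le> real ?t \<and> covers m a j (age_cell m ?t (T k i \<omega>)) (Z k i \<omega>)})"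
          proof
            fix q assume q: "q \<in> ?A"
            obtain k' i where q_eq: "q = (k', i)" by fastforce
            obtain d' s' where Z_eq: "Z k' i \<omega> = (d', s')" by fastforce
            have arr: "k' \<in> {1..K}" "T k' i \<omega> < real ?t" "T k' i \<omega> + real d' \<le> real ?t + x"
              "real ?t + x \<le> T k' i \<omega> + real d' + real s'"
              using q unfolding q_eq by (simp_all add: Z_eq)
            then have "covers m a j (age_cell m ?t (T k' i \<omega>)) (Z k' i \<omega>)"
              unfolding j_def Z_eq by (intro coversI[OF m _ ax]) auto
            then show "q \<in> (SIGMA k:{1..K}. {i. T k i \<omega> \<le> real ?t \<and> covers m a j (age_cell m ?t (T k i \<omega>)) (Z k i \<omega>)})"
              using arr unfolding q_eq by simp
          qed
        qed
        also have "\<dots> = point_count m ?t (covers m a j) \<omega>"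
          unfolding point_count_def
          by (rule card_SigmaI) (use elim(4) in \<open>auto intro: rev_finite_subset\<close>)
        finally show "\<omega> \<in> {\<omega>\<in>space M. \<exists>j\<le>m * W. C \<le> point_count m ?t (covers m a j) \<omega>}"
          using jW elim(3) by auto
      qed
    qed
  qed measurable
  finally show ?thesis .
qed

lemma traffic_intensity_eq:
  "traffic_intensity K rate p = (\<Sum>k=1..K. rate k * (\<Sum>z\<in>set_pmf (p k). pmf (p k) z * real (snd z)))"
  unfolding traffic_intensity_def
proof (intro sum.cong refl arg_cong2[of _ _ _ _ "(*)"])
  fix k assume k: "k \<in> {1..K}"
  show "measure_pmf.expectation (p k) (\<lambda>(d, s). real s) = (\<Sum>z\<in>set_pmf (p k). pmf (p k) z * real (snd z))"
    by (subst integral_measure_pmf_real[OF finite_requests[OF k]]) (auto simp: case_prod_beta mult.commute)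
qed

text \<open>Service times are at least \<open>1\<close>.\<close>

lemma total_rate_le_traffic_intensity: "(\<Sum>k=1..K. rate k) \<le> traffic_intensity K rate p"
  unfolding traffic_intensity_eq
proof (rule sum_mono)
  fix k assume k: "k \<in> {1..K}"
  have "1 = (\<Sum>z\<in>set_pmf (p k). pmf (p k) z)" using sum_pmf_requests[OF k] by simp
  also have "\<dots> \<le> (\<Sum>z\<in>set_pmf (p k). pmf (p k) z * real (snd z))"
    using service_pos[OF k] by (intro sum_mono) (force simp: mult_le_cancel_left1 Suc_le_eq)
  finally show "rate k \<le> rate k * (\<Sum>z\<in>set_pmf (p k). pmf (p k) z * real (snd z))"
    using rate_pos[OF k] by simp
qed

lemma grid_length:
  assumes "0 < m" "k \<in> {1..K}" "(d, s) \<in> set_pmf (p k)"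
  shows "m * (d + s) < m * (W + 1)"
proof -
  have "d + s < W + 1" using horizon[OF assms(2,3)] by simp
  then show ?thesis using assms(1) by (rule mult_less_mono2)
qed

lemma mean_count_covers_le:
  assumes m: "0 < m"
  shows "mean_count m (W + 1) (covers m a j) \<le> traffic_intensity K rate p + 2 / real m * (\<Sum>k=1..K. rate k)"
proof -
  have "mean_count m (W + 1) (covers m a j)
      \<le> (\<Sum>k=1..K. rate k / real m * (\<Sum>z\<in>set_pmf (p k). pmf (p k) z * (real m * real (snd z) + 2)))"
    unfolding mean_count_def
  proof (intro sum_mono mult_left_mono)
    fix k z assume k: "k \<in> {1..K}" and z: "z \<in> set_pmf (p k)"
    obtain d s where ds: "z = (d, s)" by fastforce
    have R: "m * (d + s) < m * (W + 1)" and ad: "a \<le> d"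
      using grid_length[OF m k] reservation_ge[OF k] z ds by auto
    have "card {r. r < m * (W + 1) \<and> covers m a j r z} \<le> m * s + 2"
      using card_covers_le_card_covers_0[OF ad R, of j] card_covers_0_le[OF ad R] ds by simp
    then show "real (card {r. r < m * (W + 1) \<and> covers m a j r z}) \<le> real m * real (snd z) + 2"
      unfolding ds by (simp flip: of_nat_mult)
  qed (use rate_pos in \<open>auto simp: less_imp_le\<close>)
  also have "\<dots> = (\<Sum>k=1..K. rate k * (\<Sum>z\<in>set_pmf (p k). pmf (p k) z * real (snd z)) + 2 / real m * rate k)"
  proof (rule sum.cong[OF refl])
    fix k assume k: "k \<in> {1..K}"
    have "(\<Sum>z\<in>set_pmf (p k). pmf (p k) z * (real m * real (snd z) + 2))
       = real m * (\<Sum>z\<in>set_pmf (p k). pmf (p k) z * real (snd z)) + 2 * (\<Sum>z\<in>set_pmf (p k). pmf (p k) z)"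
      by (simp add: sum_distrib_left sum.distrib distrib_left mult_ac)
    then show "rate k / real m * (\<Sum>z\<in>set_pmf (p k). pmf (p k) z * (real m * real (snd z) + 2))
      = rate k * (\<Sum>z\<in>set_pmf (p k). pmf (p k) z * real (snd z)) + 2 / real m * rate k"
      using m by (simp add: sum_pmf_requests[OF k] field_simps)
  qed
  also have "\<dots> = traffic_intensity K rate p + 2 / real m * (\<Sum>k=1..K. rate k)"
    by (simp add: traffic_intensity_eq sum.distrib sum_distrib_left)
  finally show ?thesis .
qed

lemma traffic_intensity_le_mean_count:
  assumes m: "0 < m"
  shows "traffic_intensity K rate p \<le> mean_count m (W + 1) (covers m a 0)"
  unfolding traffic_intensity_eq mean_count_def
proof (rule sum_mono)
  fix k assume k: "k \<in> {1..K}"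
  have "(\<Sum>z\<in>set_pmf (p k). pmf (p k) z * real (m * snd z))
      \<le> (\<Sum>z\<in>set_pmf (p k). pmf (p k) z * real (card {r. r < m * (W + 1) \<and> covers m a 0 r z}))"
  proof (intro sum_mono mult_left_mono)
    fix z assume z: "z \<in> set_pmf (p k)"
    obtain d s where ds: "z = (d, s)" by fastforce
    have R: "m * (d + s) < m * (W + 1)" and ad: "a \<le> d"
      using grid_length[OF m k] reservation_ge[OF k] z ds by auto
    show "real (m * snd z) \<le> real (card {r. r < m * (W + 1) \<and> covers m a 0 r z})"
      unfolding ds snd_conv of_nat_le_iff by (rule le_card_covers_0[OF ad R])
  qed simp
  then have "rate k / real m * (\<Sum>z\<in>set_pmf (p k). pmf (p k) z * real (m * snd z))
    \<le> rate k / real m * (\<Sum>z\<in>set_pmf (p k). pmf (p k) z * real (card {r. r < m * (W + 1) \<and> covers m a 0 r z}))"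
    using rate_pos[OF k] by (intro mult_left_mono) auto
  moreover have "(\<Sum>z\<in>set_pmf (p k). pmf (p k) z * real (m * snd z)) = real m * (\<Sum>z\<in>set_pmf (p k). pmf (p k) z * real (snd z))"
    by (simp add: sum_distrib_left mult_ac)
  ultimately show "rate k * (\<Sum>z\<in>set_pmf (p k). pmf (p k) z * real (snd z))
    \<le> rate k / real m * (\<Sum>z\<in>set_pmf (p k). pmf (p k) z * real (card {r. r < m * (W + 1) \<and> covers m a 0 r z}))"
    using m by simp
qed

text \<open>The count in cell \<open>j\<close> exceeds that in cell \<open>0\<close> by gains minus losses. Every request loses at least as
much as it gains, both at most \<open>j\<close> cells, and requests \<open>(a, s0)\<close> lose at least \<open>j / W\<close> cells without any gain.
So the drift is negative and of the same order in \<open>j\<close> as the variance: one \<open>\<theta>\<close> makes the exponent nonpositive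
for all \<open>j\<close> at once, and Markov's inequality yields a bound that is uniform in the cell and the grid.\<close>

lemma prob_point_count_growth:
  assumes m: "0 < m" and j: "j \<le> m * W"
    and k0: "k0 \<in> {1..K}" and z0: "(a, s0) \<in> set_pmf (p k0)"
    and \<theta>: "0 \<le> \<theta>" "\<theta> \<le> 1" "2 * \<theta> * real W * (\<Sum>k=1..K. rate k) \<le> rate k0 * pmf (p k0) (a, s0)"
  shows "prob {\<omega>\<in>space M. y \<le> real (point_count m (W + 1) (covers m a j) \<omega>) - real (point_count m (W + 1) (covers m a 0) \<omega>)}
      \<le> exp (- \<theta> * y)"
proof -
  let ?t = "W + 1"
  let ?D = "\<lambda>z. \<Sum>r<m * ?t. exp (\<theta> * of_bool (covers m a j r z) + (- \<theta>) * of_bool (covers m a 0 r z)) - 1"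
  have D_le: "?D z \<le> 2 * real j * \<theta>\<^sup>2 - (if k = k0 \<and> z = (a, s0) then \<theta> * real j / real W else 0)"
    if k: "k \<in> {1..K}" and z: "z \<in> set_pmf (p k)" for k z
  proof -
    obtain d s where ds: "z = (d, s)" by fastforce
    have R: "m * (d + s) < m * ?t" and ad: "a \<le> d"
      using grid_length[OF m k] reservation_ge[OF k] z ds by auto
    let ?J = "{r. r < m * ?t \<and> covers m a j r (d, s)}" and ?O = "{r. r < m * ?t \<and> covers m a 0 r (d, s)}"
    define gain where "gain = real (card (?J - ?O))"
    define loss where "loss = real (card (?O - ?J))"
    have "?D z = (\<Sum>r<m * ?t. exp (\<theta> * (of_bool (covers m a j r z) - of_bool (covers m a 0 r z))) - 1)"
      by (simp add: right_diff_distrib)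
    also have "\<dots> \<le> \<theta> * (real (card (?J - ?O)) - real (card (?O - ?J))) + \<theta>\<^sup>2 * (real (card (?J - ?O)) + real (card (?O - ?J)))"
      using sum_exp_indicator_diff_le[of "{..<m * ?t}" \<theta> "\<lambda>r. covers m a j r z" "\<lambda>r. covers m a 0 r z"] \<theta>
      unfolding ds by simp
    finally have D: "?D z \<le> \<theta> * (gain - loss) + \<theta>\<^sup>2 * (gain + loss)"
      unfolding gain_def loss_def .
    have "gain \<le> loss" "loss \<le> real j"
      using card_covers_diff_le[OF ad R] card_covers_0_diff_le[OF ad R] unfolding gain_def loss_def by auto
    then have "\<theta>\<^sup>2 * (gain + loss) \<le> \<theta>\<^sup>2 * (2 * real j)"
      by (intro mult_left_mono) auto
    moreover have "\<theta> * (gain - loss) \<le> - (if k = k0 \<and> z = (a, s0) then \<theta> * real j / real W else 0)"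
    proof (cases "k = k0 \<and> z = (a, s0)")
      case True
      then have d: "a = d" "0 < s" using ds service_pos[OF k0 z0] by auto
      have W: "0 < W" using service_pos[OF k0 z0] horizon[OF k0 z0] by simp
      have "?J - ?O = {}" using card_covers_loss(1)[OF ad R d] by blast
      then have "gain = 0" unfolding gain_def by (simp only: card.empty of_nat_0)
      moreover have "real j / real W \<le> loss"
      proof -
        have "j \<le> min j m * W" using j W by (auto simp: min_def)
        then have "real j \<le> real (min j m) * real W" by (metis of_nat_le_iff of_nat_mult)
        also have "\<dots> \<le> loss * real W"
          using card_covers_loss(2)[OF ad R d, of j] unfolding loss_def by (intro mult_right_mono) auto
        finally show ?thesis using W by (simp add: divide_le_eq)
      qed
      ultimately show ?thesis
        using True mult_left_mono[OF _ \<theta>(1), of "real j / real W" loss] by simp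
    next
      case False
      then show ?thesis using \<open>gain \<le> loss\<close> \<theta>(1) by (auto intro!: mult_nonneg_nonpos)
    qed
    ultimately show ?thesis using D by (simp add: mult_ac)
  qed
  have "(\<Sum>k=1..K. rate k / real m * (\<Sum>z\<in>set_pmf (p k). pmf (p k) z * ?D z))
     \<le> (\<Sum>k=1..K. rate k / real m * (\<Sum>z\<in>set_pmf (p k). pmf (p k) z *
          (2 * real j * \<theta>\<^sup>2 - (if k = k0 \<and> z = (a, s0) then \<theta> * real j / real W else 0))))"
    using rate_pos by (intro sum_mono mult_left_mono D_le) (auto simp: less_imp_le)
  also have "\<dots> = (\<Sum>k=1..K. rate k / real m * (2 * real j * \<theta>\<^sup>2)
        - (if k = k0 then rate k / real m * (pmf (p k) (a, s0) * (\<theta> * real j / real W)) else 0))"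
  proof (rule sum.cong[OF refl])
    fix k assume k: "k \<in> {1..K}"
    have "(\<Sum>z\<in>set_pmf (p k). pmf (p k) z * (2 * real j * \<theta>\<^sup>2 - (if k = k0 \<and> z = (a, s0) then \<theta> * real j / real W else 0)))
      = (\<Sum>z\<in>set_pmf (p k). pmf (p k) z) * (2 * real j * \<theta>\<^sup>2)
        - (\<Sum>z\<in>set_pmf (p k). if z = (a, s0) then (if k = k0 then pmf (p k) (a, s0) * (\<theta> * real j / real W) else 0) else 0)"
      unfolding sum_distrib_right sum_subtractf[symmetric] by (intro sum.cong) (auto simp: right_diff_distrib)
    also have "\<dots> = 2 * real j * \<theta>\<^sup>2 - (if k = k0 then pmf (p k) (a, s0) * (\<theta> * real j / real W) else 0)"
      using sum_pmf_requests[OF k] finite_requests[OF k] z0 by simp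
    finally show "rate k / real m * (\<Sum>z\<in>set_pmf (p k). pmf (p k) z * (2 * real j * \<theta>\<^sup>2 - (if k = k0 \<and> z = (a, s0) then \<theta> * real j / real W else 0)))
      = rate k / real m * (2 * real j * \<theta>\<^sup>2) - (if k = k0 then rate k / real m * (pmf (p k) (a, s0) * (\<theta> * real j / real W)) else 0)"
      by (simp add: right_diff_distrib)
  qed
  also have "\<dots> = (\<Sum>k=1..K. rate k) / real m * (2 * real j * \<theta>\<^sup>2) - rate k0 / real m * (pmf (p k0) (a, s0) * (\<theta> * real j / real W))"
    unfolding sum_subtractf sum_distrib_right[symmetric] sum_divide_distrib[symmetric] using k0 by simp
  also have "\<dots> = real j * \<theta> / (real m * real W) * (2 * \<theta> * real W * (\<Sum>k=1..K. rate k) - rate k0 * pmf (p k0) (a, s0))"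
  proof -
    have "0 < W" using service_pos[OF k0 z0] horizon[OF k0 z0] by simp
    moreover have "L / m' * (2 * j' * \<theta>\<^sup>2) - r / m' * (b * (\<theta> * j' / W')) = j' * \<theta> / (m' * W') * (2 * \<theta> * W' * L - r * b)"
      if "0 < m'" "0 < W'" for L m' j' r b W' :: real
      using that by (simp add: field_simps power2_eq_square)
    ultimately show ?thesis using m by simp
  qed
  also have "\<dots> \<le> 0"
    using \<theta> by (intro mult_nonneg_nonpos) auto
  finally have exponent: "(\<Sum>k=1..K. rate k / real m * (\<Sum>z\<in>set_pmf (p k). pmf (p k) z * ?D z)) \<le> 0" .
  let ?X = "\<lambda>\<omega>. real (point_count m ?t (covers m a j) \<omega>) - real (point_count m ?t (covers m a 0) \<omega>)"
  have "exp (\<theta> * ?X \<omega>) = exp (\<theta> * real (point_count m ?t (covers m a j) \<omega>)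
      + (- \<theta>) * real (point_count m ?t (covers m a 0) \<omega>))" for \<omega>
    by (simp only: right_diff_distrib mult_minus_left add_uminus_conv_diff)
  then have "(\<integral>\<^sup>+\<omega>. ennreal (exp (\<theta> * ?X \<omega>)) \<partial>M)
      = ennreal (exp (\<Sum>k=1..K. rate k / real m * (\<Sum>z\<in>set_pmf (p k). pmf (p k) z * ?D z)))"
    by (simp only: nn_integral_exp_point_counts[OF m])
  also have "\<dots> \<le> ennreal 1"
    using exponent by (intro ennreal_leI) (simp only: exp_le_one_iff)
  finally have "prob {\<omega>\<in>space M. y \<le> ?X \<omega>} \<le> 1 * exp (- \<theta> * y)"
    by (intro chernoff_bound \<theta>(1) zero_le_one) measurable
  then show ?thesis by (simp only: mult_1)
qed

text \<open>Useful for capacities that exceed the traffic intensity by a fixed proportion: every cell count is Poisson with mean at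
most \<open>\<rho> + 2 \<Lambda> / m\<close>, and there are \<open>m * W + 1\<close> cells in the range of any request.\<close>

theorem blocking_prob_le_exponential:
  assumes m: "0 < m" and k: "k \<in> {1..K}" and ds: "(d, s) \<in> set_pmf (p k)" and \<theta>: "0 \<le> \<theta>"
  shows "blocking_prob \<pi> C d s \<le> real (m * W + 1) *
    exp ((traffic_intensity K rate p + 2 / real m * (\<Sum>k=1..K. rate k)) * (exp \<theta> - 1) - \<theta> * real C)"
proof -
  let ?N = "\<lambda>j \<omega>. point_count m (W + 1) (covers m a j) \<omega>"
  let ?b = "exp ((traffic_intensity K rate p + 2 / real m * (\<Sum>k=1..K. rate k)) * (exp \<theta> - 1))"
  have events: "{\<omega>\<in>space M. real C \<le> real (?N j \<omega>)} \<in> events" for j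
    by measurable
  have "blocking_prob \<pi> C d s \<le> prob {\<omega>\<in>space M. \<exists>j\<le>m * W. C \<le> ?N j \<omega>}"
    by (rule blocking_prob_le_union[OF m k ds])
  also have "\<dots> = prob (\<Union>j\<le>m * W. {\<omega>\<in>space M. real C \<le> real (?N j \<omega>)})"
    by (intro arg_cong[of _ _ prob]) auto
  also have "\<dots> \<le> (\<Sum>j\<le>m * W. prob {\<omega>\<in>space M. real C \<le> real (?N j \<omega>)})"
    by (rule finite_measure_subadditive_finite) (use events in auto)
  also have "\<dots> \<le> (\<Sum>j\<le>m * W. ?b * exp (- \<theta> * real C))"
  proof (intro sum_mono chernoff_bound)
    fix j
    show "(\<integral>\<^sup>+\<omega>. ennreal (exp (\<theta> * real (?N j \<omega>))) \<partial>M) \<le> ennreal ?b"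
      unfolding nn_integral_exp_point_count[OF m]
      using mean_count_covers_le[OF m, of j] \<theta> by (intro ennreal_leI) (simp add: mult_right_mono)
  qed (use \<theta> in auto)
  also have "\<dots> = real (m * W + 1) * exp ((traffic_intensity K rate p + 2 / real m * (\<Sum>k=1..K. rate k)) * (exp \<theta> - 1) - \<theta> * real C)"
  proof -
    have "?b * exp (- \<theta> * real C)
        = exp ((traffic_intensity K rate p + 2 / real m * (\<Sum>k=1..K. rate k)) * (exp \<theta> - 1) - \<theta> * real C)"
      by (simp only: mult_exp_exp) simp
    then show ?thesis by (simp only: sum_constant) simp
  qed
  finally show ?thesis .
qed

text \<open>Useful for capacities close to the traffic intensity: blocking requires that the count at cell \<open>0\<close>
comes within \<open>y\<close> of the capacity, or that the count at some later cell exceeds it by \<open>y\<close>, which is exponentially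
unlikely in \<open>y\<close>.\<close>

theorem blocking_prob_le_poisson_tail:
  assumes m: "0 < m" and k: "k \<in> {1..K}" and ds: "(d, s) \<in> set_pmf (p k)"
    and k0: "k0 \<in> {1..K}" and z0: "(a, s0) \<in> set_pmf (p k0)"
    and \<theta>: "0 \<le> \<theta>" "\<theta> \<le> 1" "2 * \<theta> * real W * (\<Sum>k=1..K. rate k) \<le> rate k0 * pmf (p k0) (a, s0)"
    and pos: "0 < traffic_intensity K rate p"
  shows "blocking_prob \<pi> C d s \<le>
    measure_pmf.prob (poisson_pmf (mean_count m (W + 1) (covers m a 0))) {n. real C - y \<le> real n}
    + real (m * W + 1) * exp (- \<theta> * y)"
proof -
  let ?N = "\<lambda>j \<omega>. point_count m (W + 1) (covers m a j) \<omega>"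
  let ?A = "{\<omega>\<in>space M. real C - y \<le> real (?N 0 \<omega>)}"
  let ?G = "\<lambda>j. {\<omega>\<in>space M. y \<le> real (?N j \<omega>) - real (?N 0 \<omega>)}"
  have A[measurable]: "?A \<in> events" and G[measurable]: "?G j \<in> events" for j
    by measurable
  have "prob ?A = measure (distr M (count_space UNIV) (?N 0)) {n. real C - y \<le> real n}"
    unfolding measure_distr[OF measurable_point_count sets_UNIV]
    by (rule arg_cong[of _ _ prob]) blast
  also have "\<dots> = measure_pmf.prob (poisson_pmf (mean_count m (W + 1) (covers m a 0))) {n. real C - y \<le> real n}"
    by (simp only: point_count_poisson[OF m less_le_trans[OF pos traffic_intensity_le_mean_count[OF m]]])
  finally have A_law: "prob ?A = measure_pmf.prob (poisson_pmf (mean_count m (W + 1) (covers m a 0))) {n. real C - y \<le> real n}" .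
  have "blocking_prob \<pi> C d s \<le> prob {\<omega>\<in>space M. \<exists>j\<le>m * W. C \<le> ?N j \<omega>}"
    by (rule blocking_prob_le_union[OF m k ds])
  also have "\<dots> \<le> prob (?A \<union> (\<Union>j\<le>m * W. ?G j))"
  proof (rule finite_measure_mono)
    show "{\<omega>\<in>space M. \<exists>j\<le>m * W. C \<le> ?N j \<omega>} \<subseteq> ?A \<union> (\<Union>j\<le>m * W. ?G j)"
    proof
      fix \<omega> assume "\<omega> \<in> {\<omega>\<in>space M. \<exists>j\<le>m * W. C \<le> ?N j \<omega>}"
      then obtain j where \<omega>: "\<omega> \<in> space M" and j: "j \<le> m * W" and "C \<le> ?N j \<omega>" by blast
      then have "real C - y \<le> real (?N 0 \<omega>) \<or> y \<le> real (?N j \<omega>) - real (?N 0 \<omega>)" by linarith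
      then show "\<omega> \<in> ?A \<union> (\<Union>j\<le>m * W. ?G j)" using \<omega> j by auto
    qed
  qed measurable
  also have "\<dots> \<le> prob ?A + prob (\<Union>j\<le>m * W. ?G j)"
    by (rule measure_Un_le) measurable
  also have "\<dots> \<le> prob ?A + (\<Sum>j\<le>m * W. prob (?G j))"
    by (intro add_left_mono finite_measure_subadditive_finite) (use G in blast)+
  also have "\<dots> \<le> prob ?A + (\<Sum>j\<le>m * W. exp (- \<theta> * y))"
    by (intro add_left_mono sum_mono prob_point_count_growth[OF m _ k0 z0 \<theta>]) simp
  finally show ?thesis unfolding A_law by simp
qed

end

section \<open>Asymptotics of the blocking probabilities\<close>

theorem theorem1:
  fixes K :: nat and u v :: "nat \<Rightarrow> nat"
    and p :: "nat \<Rightarrow> (nat \<times> nat) pmf"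
    and q :: "nat \<Rightarrow> real"
    and rate :: "nat \<Rightarrow> nat \<Rightarrow> real"
    and C :: "nat \<Rightarrow> nat"
    and M :: "nat \<Rightarrow> 'a measure"
    and T :: "nat \<Rightarrow> nat \<Rightarrow> nat \<Rightarrow> 'a \<Rightarrow> real"
    and Z :: "nat \<Rightarrow> nat \<Rightarrow> nat \<Rightarrow> 'a \<Rightarrow> nat \<times> nat"
    and B :: "nat \<Rightarrow> real \<Rightarrow> 'a \<Rightarrow> real \<Rightarrow> nat"
    and \<pi> :: "nat \<Rightarrow> (real \<Rightarrow> nat) measure"
  assumes network: "\<And>n. stationary_loss_network (M n) K u v p (rate n) (C n) (T n) (Z n) (B n) (\<pi> n)"
    and proportions: "\<And>n k. k \<in> {1..K} \<Longrightarrow> rate n k / (\<Sum>j=1..K. rate n j) = q k"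
    and capacity: "filterlim C at_top sequentially"
  shows "((\<forall>n. real (C n) = traffic_intensity K (rate n) p) \<longrightarrow>
            (\<forall>k\<in>{1..K}. \<forall>d s. (d, s) \<in> set_pmf (p k) \<longrightarrow>
               limsup (\<lambda>n. ereal (blocking_prob (\<pi> n) (C n) d s)) \<le> ereal (1 / 2)))
       \<and> (\<forall>\<epsilon>>0. (\<forall>n. real (C n) = (1 + \<epsilon>) * traffic_intensity K (rate n) p) \<longrightarrow>
            (\<forall>k\<in>{1..K}. \<forall>d s. (d, s) \<in> set_pmf (p k) \<longrightarrow>
               (\<lambda>n. blocking_prob (\<pi> n) (C n) d s) \<longlonglongrightarrow> 0))"
proof (cases "K = 0")
  case True
  then show ?thesis by simp
next
  case False
  define requests where "requests = (\<Union>k\<in>{1..K}. set_pmf (p k))"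
  have fin: "finite requests"
    unfolding requests_def using stationary_loss_network.finite_requests[OF network] by auto
  have ne: "requests \<noteq> {}"
    unfolding requests_def using False set_pmf_not_empty by fastforce
  define a where "a = Min (fst ` requests)"
  define W where "W = Max ((\<lambda>(d, s). d + s) ` requests)"
  have bounded: "bounded_requests (M n) K u v p (rate n) (C n) (T n) (Z n) (B n) (\<pi> n) a W" for n
  proof -
    interpret stationary_loss_network "M n" K u v p "rate n" "C n" "T n" "Z n" "B n" "\<pi> n"
      by (rule network)
    show ?thesis
    proof unfold_locales
      fix k d s assume "k \<in> {1..K}" "(d, s) \<in> set_pmf (p k)"
      then have ds: "(d, s) \<in> requests" by (auto simp: requests_def)
      then show "a \<le> d" unfolding a_def using fin by (intro Min_le) force+
      show "d + s \<le> W" unfolding W_def using fin ds by (intro Max_ge) force+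
    qed
  qed
  have "a \<in> fst ` requests" unfolding a_def using fin ne by (intro Min_in) auto
  then obtain k0 s0 where k0: "k0 \<in> {1..K}" and z0: "(a, s0) \<in> set_pmf (p k0)"
    by (auto simp: requests_def)
  define \<Lambda> where "\<Lambda> n = (\<Sum>k=1..K. rate n k)" for n
  have rate_pos: "0 < rate n k" if "k \<in> {1..K}" for n k
    using stationary_loss_network.rate_pos[OF network that] .
  have \<Lambda>_pos: "0 < \<Lambda> n" for n
    unfolding \<Lambda>_def using k0 rate_pos by (intro sum_pos) auto
  have \<Lambda>_le: "\<Lambda> n \<le> traffic_intensity K (rate n) p" for n
    unfolding \<Lambda>_def by (rule bounded_requests.total_rate_le_traffic_intensity[OF bounded])
  have real_C: "filterlim (\<lambda>n. real (C n)) at_top sequentially"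
    by (rule filterlim_compose[OF filterlim_real_sequentially capacity])

  have part_a: "limsup (\<lambda>n. ereal (blocking_prob (\<pi> n) (C n) d s)) \<le> ereal (1 / 2)"
    if C: "\<forall>n. real (C n) = traffic_intensity K (rate n) p"
      and k: "k \<in> {1..K}" and ds: "(d, s) \<in> set_pmf (p k)" for k d s
  proof -
    \<comment> \<open>As the proportions of the classes are fixed, this rate is the same for all networks of the sequence.\<close>
    define \<theta> where "\<theta> = q k0 * pmf (p k0) (a, s0) / (2 * real W)"
    have W: "1 \<le> W"
      using bounded_requests.service_pos[OF bounded k0 z0] bounded_requests.horizon[OF bounded k0 z0] by simp
    have q0: "rate n k0 = q k0 * \<Lambda> n" for n
      using proportions[OF k0, of n] \<Lambda>_pos[of n] by (auto simp: \<Lambda>_def field_simps)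
    have "0 < q k0"
      using q0[of 0] rate_pos[OF k0, of 0] \<Lambda>_pos[of 0] by (simp add: zero_less_mult_iff)
    have "rate 0 k0 \<le> \<Lambda> 0"
      unfolding \<Lambda>_def using k0 rate_pos by (intro member_le_sum) (auto simp: less_imp_le)
    then have "q k0 \<le> 1" using q0[of 0] \<Lambda>_pos[of 0] by simp
    have "0 < pmf (p k0) (a, s0)" using z0 by (simp add: pmf_positive_iff)
    then have \<theta>_pos: "0 < \<theta>" using \<open>0 < q k0\<close> W by (simp add: \<theta>_def)
    have "q k0 * pmf (p k0) (a, s0) \<le> 1"
      using \<open>0 < q k0\<close> \<open>q k0 \<le> 1\<close> by (intro mult_le_one) (auto simp: pmf_le_1)
    then have \<theta>_le: "\<theta> \<le> 1" unfolding \<theta>_def using W by (simp add: divide_le_eq)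
    have \<theta>_rate: "2 * \<theta> * real W * (\<Sum>k=1..K. rate n k) \<le> rate n k0 * pmf (p k0) (a, s0)" for n
      using W unfolding q0 \<Lambda>_def[symmetric] \<theta>_def by simp
    have C_pos: "0 < C n" for n
    proof -
      have "0 < real (C n)" using C \<Lambda>_pos[of n] \<Lambda>_le[of n] by simp
      then show ?thesis by simp
    qed
    \<comment> \<open>The grid step is \<open>1 / C\<close>, so that the discretisation adds at most \<open>2\<close> to the mean.\<close>
    define \<mu> where "\<mu> n = stationary_loss_network.mean_count K p (rate n) (C n) (W + 1) (covers (C n) a 0)" for n
    have \<mu>_ge: "real (C n) \<le> \<mu> n" for n
      using bounded_requests.traffic_intensity_le_mean_count[OF bounded C_pos] C unfolding \<mu>_def by simp
    have \<mu>_le: "\<mu> n \<le> real (C n) + 2" for n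
    proof -
      have "\<mu> n \<le> real (C n) + 2 / real (C n) * \<Lambda> n"
        using bounded_requests.mean_count_covers_le[OF bounded C_pos] C unfolding \<mu>_def \<Lambda>_def by simp
      moreover have "\<Lambda> n \<le> real (C n)" using C \<Lambda>_le[of n] by simp
      then have "2 / real (C n) * \<Lambda> n \<le> 2" using C_pos[of n] by (simp only: times_divide_eq_left divide_le_eq) simp
      ultimately show ?thesis by linarith
    qed
    \<comment> \<open>Any power of \<open>C\<close> strictly between \<open>0\<close> and \<open>1/2\<close> works: \<open>y\<close> must be \<open>o(sqrt C)\<close> and dominate \<open>ln C\<close>.\<close>
    define y where "y n = real (C n) powr (1 / 4)" for n
    let ?tail = "\<lambda>n. measure_pmf.prob (poisson_pmf (\<mu> n)) {j. \<mu> n - (2 + y n) \<le> real j}"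
    let ?err = "\<lambda>n. real (C n * W + 1) * exp (- \<theta> * y n)"
    have "blocking_prob (\<pi> n) (C n) d s \<le> ?tail n + ?err n" for n
    proof -
      have "0 < traffic_intensity K (rate n) p" using \<Lambda>_pos[of n] \<Lambda>_le[of n] by simp
      then have "blocking_prob (\<pi> n) (C n) d s \<le> measure_pmf.prob (poisson_pmf (\<mu> n)) {j. real (C n) - y n \<le> real j} + ?err n"
        unfolding \<mu>_def
        using bounded_requests.blocking_prob_le_poisson_tail[OF bounded[of n] C_pos[of n] k ds k0 z0 _ \<theta>_le \<theta>_rate[of n], where y = "y n"] \<theta>_pos
        by simp
      also have "measure_pmf.prob (poisson_pmf (\<mu> n)) {j. real (C n) - y n \<le> real j} \<le> ?tail n"
        using \<mu>_le[of n] by (intro measure_pmf.finite_measure_mono) auto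
      finally show ?thesis by simp
    qed
    then have "limsup (\<lambda>n. ereal (blocking_prob (\<pi> n) (C n) d s)) \<le> limsup (\<lambda>n. ereal (?err n) + ereal (?tail n))"
      by (intro Limsup_mono always_eventually allI) (simp add: add.commute)
    also have "\<dots> = 0 + limsup (\<lambda>n. ereal (?tail n))"
    proof (rule ereal_limsup_lim_add)
      have "((\<lambda>x. (x * real W + 1) * exp (- \<theta> * x powr (1 / 4))) \<longlongrightarrow> 0) at_top"
        using \<theta>_pos by real_asymp
      from filterlim_compose[OF this real_C]
      have "?err \<longlonglongrightarrow> 0" by (simp add: y_def add.commute)
      then show "(\<lambda>n. ereal (?err n)) \<longlonglongrightarrow> 0" by (simp add: zero_ereal_def)
    qed simp
    also have "limsup (\<lambda>n. ereal (?tail n)) \<le> ereal (1 / 2)"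
    proof (rule limsup_poisson_tail_le_half)
      show "filterlim \<mu> at_top sequentially"
        by (rule filterlim_at_top_mono[OF real_C]) (simp add: \<mu>_ge)
      show \<mu>_pos: "0 < \<mu> n" for n using \<mu>_ge[of n] C_pos[of n] by (simp add: less_le_trans)
      have "((\<lambda>x. (2 + x powr (1 / 4)) / sqrt x) \<longlongrightarrow> 0) at_top"
        by real_asymp
      from filterlim_compose[OF this real_C]
      have lim: "(\<lambda>n. (2 + y n) / sqrt (real (C n))) \<longlonglongrightarrow> 0" by (simp add: y_def)
      show "(\<lambda>n. (2 + y n) / sqrt (\<mu> n)) \<longlonglongrightarrow> 0"
      proof (rule tendsto_sandwich[OF _ _ tendsto_const lim])
        show "eventually (\<lambda>n. 0 \<le> (2 + y n) / sqrt (\<mu> n)) sequentially"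
          using \<mu>_pos by (intro always_eventually allI divide_nonneg_pos) (auto simp: y_def)
        show "eventually (\<lambda>n. (2 + y n) / sqrt (\<mu> n) \<le> (2 + y n) / sqrt (real (C n))) sequentially"
          using \<mu>_ge C_pos by (intro always_eventually allI divide_left_mono) (auto simp: y_def \<mu>_pos)
      qed
    qed
    finally show ?thesis by simp
  qed

  have part_b: "(\<lambda>n. blocking_prob (\<pi> n) (C n) d s) \<longlonglongrightarrow> 0"
    if \<epsilon>: "0 < \<epsilon>" and C: "\<forall>n. real (C n) = (1 + \<epsilon>) * traffic_intensity K (rate n) p"
      and k: "k \<in> {1..K}" and ds: "(d, s) \<in> set_pmf (p k)" for \<epsilon> k d s
  proof -
    define m where "m = nat \<lceil>4 / \<epsilon>\<rceil>"
    have m: "0 < m" using \<epsilon> by (simp add: m_def)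
    have "4 / \<epsilon> \<le> real m" unfolding m_def by linarith
    then have m_eps: "2 / real m \<le> \<epsilon> / 2" using \<epsilon> m by (simp add: field_simps)
    define \<theta> where "\<theta> = \<epsilon> / (4 + 2 * \<epsilon>)"
    have \<theta>: "0 < \<theta>" "\<theta> \<le> 1" using \<epsilon> by (auto simp: \<theta>_def divide_le_eq)
    \<comment> \<open>With this \<open>\<theta>\<close>, \<open>(1 + \<epsilon>/2) (1 + \<theta>) = 1 + 3\<epsilon>/4\<close>, which leaves a margin of \<open>\<epsilon>/4\<close> below \<open>1 + \<epsilon>\<close>.\<close>
    define c where "c = (\<theta> * \<epsilon> / 4) / (1 + \<epsilon>)"
    have c: "0 < c" using \<epsilon> \<theta> by (simp add: c_def)
    have bound: "blocking_prob (\<pi> n) (C n) d s \<le> real (m * W + 1) * exp (- c * real (C n))" for n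
    proof -
      let ?\<rho> = "traffic_intensity K (rate n) p"
      have \<rho>: "0 < ?\<rho>" using \<Lambda>_pos[of n] \<Lambda>_le[of n] by simp
      have "2 / real m * \<Lambda> n \<le> \<epsilon> / 2 * ?\<rho>"
        using m_eps \<Lambda>_le[of n] \<Lambda>_pos[of n] \<epsilon> by (intro mult_mono) auto
      then have "(?\<rho> + 2 / real m * \<Lambda> n) * (exp \<theta> - 1) \<le> (?\<rho> * (1 + \<epsilon> / 2)) * (\<theta> + \<theta>\<^sup>2)"
        using exp_minus_one_le_quadratic[of \<theta>] \<theta> \<rho> \<epsilon> by (intro mult_mono) (auto simp: algebra_simps)
      also have "\<dots> = ?\<rho> * \<theta> * (1 + 3 / 4 * \<epsilon>)"
      proof -
        have "(1 + \<epsilon> / 2) * \<theta> = \<epsilon> / 4"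
          using \<epsilon> by (simp add: \<theta>_def field_simps)
        then have "(1 + \<epsilon> / 2) * (1 + \<theta>) = 1 + 3 / 4 * \<epsilon>" by (simp add: distrib_left)
        moreover have "(?\<rho> * (1 + \<epsilon> / 2)) * (\<theta> + \<theta>\<^sup>2) = ?\<rho> * \<theta> * ((1 + \<epsilon> / 2) * (1 + \<theta>))"
          by (simp add: power2_eq_square algebra_simps)
        ultimately show ?thesis by simp
      qed
      also have "\<dots> = \<theta> * real (C n) - c * real (C n)"
      proof -
        have "c * (1 + \<epsilon>) = \<theta> * \<epsilon> / 4"
          using \<epsilon> by (intro nonzero_eq_divide_eq[THEN iffD1, OF _ c_def]) simp
        then have "c * (1 + \<epsilon>) * ?\<rho> = \<theta> * \<epsilon> / 4 * ?\<rho>"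
          by (rule arg_cong[of _ _ "\<lambda>x. x * ?\<rho>"])
        then have "c * real (C n) = ?\<rho> * \<theta> * (\<epsilon> / 4)"
          using C by (simp only: mult.assoc) (simp only: mult_ac times_divide_eq_right times_divide_eq_left)
        moreover have "\<theta> * real (C n) = ?\<rho> * \<theta> * (1 + \<epsilon>)"
          using C by simp
        ultimately show ?thesis by (simp add: algebra_simps)
      qed
      finally have "(?\<rho> + 2 / real m * \<Lambda> n) * (exp \<theta> - 1) - \<theta> * real (C n) \<le> - c * real (C n)"
        by linarith
      then have "real (m * W + 1) * exp ((?\<rho> + 2 / real m * \<Lambda> n) * (exp \<theta> - 1) - \<theta> * real (C n))
          \<le> real (m * W + 1) * exp (- c * real (C n))"
        by (intro mult_left_mono) auto
      then show ?thesis
        using bounded_requests.blocking_prob_le_exponential[OF bounded[of n] m k ds less_imp_le[OF \<theta>(1)]]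
        unfolding \<Lambda>_def by linarith
    qed
    have "((\<lambda>x. real (m * W + 1) * exp (- c * x)) \<longlongrightarrow> 0) at_top"
      using c by real_asymp
    then have lim: "(\<lambda>n. real (m * W + 1) * exp (- c * real (C n))) \<longlonglongrightarrow> 0"
      using real_C by (rule filterlim_compose)
    show ?thesis
      by (rule tendsto_sandwich[OF _ _ tendsto_const lim])
        (use bound in \<open>auto simp: blocking_prob_def\<close>)
  qed

  show ?thesis using part_a part_b by blast
qed

end
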